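(* Let $T \subset \mathbb{R}^2$ be a non-degenerate triangle with integer vertices whose sides have affine lengths $a, b, c$, and assume that $a$, $b$ and $c$ are coprime. Let $X$ be uniformly distributed in $[0,1]^2$ and let $X_T = |(T+X)\cap\mathbb{Z}^2|$. Let $U_a, U_b, U_c, U_2$ be independent random variables, where for a positive integer $n$ the variable denoted $U_n$ is uniformly distributed on $\{0,1,\ldots,n-1\}$ (the four variables are mutually independent even if some of the indices $a,b,c,2$ coincide). Then the random variables $$X_T - \mathbb{E}X_T \quad\text{and}\quad S - \mathbb{E}S,\qquad S = U_a + U_b + U_c + U_2,$$ have the same distribution.
   Context: The triangle is closed and $T + X = \{t + X : t \in T\}$. The affine length of a side of an integer polygon is the number of segments into which the integer points on that side divide it; equivalently, if the side is the vector $(p,q)\in\mathbb{Z}^2\setminus\{0\}$, its affine length is $\gcd(p,q)$. For the affine side lengths of an integer triangle, any common divisor of two of them divides the third, so "coprime" can be read equivalently as $\gcd(a,b,c)=1$ or as pairwise coprime. *)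

theory Defs
  imports "HOL-Probability.Probability"
begin

definition integer_lattice :: "(real^2) set" where
  "integer_lattice = {v. \<forall>i. v $ i \<in> \<int>}"

text \<open>
  For distinct lattice points \<open>P\<close> and \<open>Q\<close>, the lattice points on the side cut it into one
  segment fewer than there are points; the endpoints are counted, so the subtraction does
  not truncate. Lemma \<open>affine_length_eq_gcd\<close> gives the equivalent description as a gcd.
\<close>
definition affine_length :: "real^2 \<Rightarrow> real^2 \<Rightarrow> nat" where
  "affine_length P Q = card (closed_segment P Q \<inter> integer_lattice) - 1"

text \<open>For compact \<open>T\<close> the intersection is finite, so \<^const>\<open>card\<close> is the true cardinality.\<close>
definition lattice_count :: "(real^2) set \<Rightarrow> real^2 \<Rightarrow> nat" where
  "lattice_count T x = card ((\<lambda>t. t + x) ` T \<inter> integer_lattice)"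

lemma affine_length_eq_gcd:
  fixes P Q :: "real^2" and p q :: int
  assumes P: "P \<in> integer_lattice"
    and pq: "Q - P = vector [of_int p, of_int q]" and nz: "(p, q) \<noteq> (0, 0)"
  shows "affine_length P Q = nat (gcd p q)"
proof -
  define g where "g = gcd p q"
  have g: "g > 0" using nz by (auto simp: g_def)
  obtain p' q' where p': "p = g * p'" and q': "q = g * q'" and cop: "coprime p' q'"
    using gcd_coprime_exists[of p q] g unfolding g_def by (metis less_irrefl mult.commute)
  define w :: "real^2" where "w = vector [of_int p', of_int q']"
  have w: "w $ 1 = of_int p'" "w $ 2 = of_int q'" by (simp_all add: w_def)
  have Q: "Q = P + of_int g *\<^sub>R w"
    using pq by (auto simp: vec_eq_iff forall_2 w p' q' algebra_simps)
  have w0: "w \<noteq> 0" using nz p' q' w by (auto simp: vec_eq_iff forall_2)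
  have "closed_segment P Q \<inter> integer_lattice = (\<lambda>k. P + of_int k *\<^sub>R w) ` {0..g}" (is "?L = ?R")
  proof (intro equalityI subsetI)
    fix v assume v: "v \<in> ?L"
    then obtain u where u: "0 \<le> u" "u \<le> 1" and vu: "v = (1 - u) *\<^sub>R P + u *\<^sub>R Q"
      by (auto simp: closed_segment_def)
    define s where "s = u * of_int g"
    have vs: "v = P + s *\<^sub>R w" unfolding vu Q s_def by (simp add: algebra_simps)
    have "v $ i - P $ i \<in> \<int>" for i
      using v P by (auto simp: integer_lattice_def)
    then have "s * of_int p' \<in> \<int>" "s * of_int q' \<in> \<int>"
      using vs w by (metis add_diff_cancel_left' vector_add_component vector_scaleR_component
          real_scaleR_def)+
    then obtain m n where m: "s * of_int p' = of_int m" and n: "s * of_int q' = of_int n"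
      by (auto elim!: Ints_cases)
    obtain x y where "x * p' + y * q' = 1" using bezout_int[of p' q'] cop by auto
    then have "s = s * of_int (x * p' + y * q')" by simp
    also have "\<dots> = of_int x * (s * of_int p') + of_int y * (s * of_int q')"
      by (simp add: algebra_simps)
    also have "\<dots> = of_int (x * m + y * n)" using m n by simp
    finally obtain k where k: "s = of_int k" by blast
    have "0 \<le> s" "s \<le> of_int g" using u g by (auto simp: s_def mult_left_le_one_le)
    then have "k \<in> {0..g}" using k by auto
    then show "v \<in> ?R" using vs k by auto
  next
    fix v assume "v \<in> ?R"
    then obtain k where k: "0 \<le> k" "k \<le> g" and v: "v = P + of_int k *\<^sub>R w" by auto
    have "v = (1 - of_int k / of_int g) *\<^sub>R P + (of_int k / of_int g) *\<^sub>R Q"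
      using g by (simp add: v Q algebra_simps)
    then have "v \<in> closed_segment P Q"
      unfolding closed_segment_def using k g
      by (auto intro!: exI[of _ "of_int k / of_int g"])
    moreover have "v \<in> integer_lattice"
      using P by (auto simp: integer_lattice_def v forall_2 w)
    ultimately show "v \<in> ?L" by simp
  qed
  moreover have "inj_on (\<lambda>k. P + of_int k *\<^sub>R w) {0..g}"
    using w0 by (auto simp: inj_on_def)
  ultimately have "card (closed_segment P Q \<inter> integer_lattice) = nat (g + 1)"
    by (simp add: card_image)
  then show ?thesis using g by (simp add: affine_length_def g_def)
qed

end

theory Submission
  imports Defs "HOL-Number_Theory.Cong"
begin

text \<open>
  Slice the translated triangle by the lines parallel to the side of length \<open>a\<close>. Summing the
  fractional parts of the slice endpoints over residue classes shows that, for almost every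
  \<open>x\<close>, the number of lattice points in \<open>T + x\<close> is a constant plus
  \<open>a {y\<^sub>1} + b {y\<^sub>2} + c {y\<^sub>3}\<close>, where the \<open>y\<^sub>i\<close> are integer linear forms in \<open>x\<close>
  with \<open>a y\<^sub>1 + b y\<^sub>2 + c y\<^sub>3 = 0\<close>.

  The uniform law on the unit cube is invariant under translations modulo 1. Since
  \<open>gcd(a, b, c) = 1\<close>, some translation shifts \<open>(y\<^sub>1, y\<^sub>2, y\<^sub>3)\<close> by \<open>(i / a, j / b, k / c)\<close> modulo 1,
  for any \<open>i, j, k\<close>. Averaging over these translations replaces \<open>a {y\<^sub>1}\<close> by
  \<open>{a y\<^sub>1} + U\<^sub>a\<close>, and likewise for the other two. What remains is
  \<open>Z = {a y\<^sub>1} + {b y\<^sub>2} + {c y\<^sub>3}\<close>, which takes the values 1 and 2, and \<open>x \<mapsto> - x\<close> exchanges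
  them, so \<open>Z\<close> is distributed as \<open>1 + U\<^sub>2\<close>.
\<close>

subsection \<open>Fractional parts over residue classes\<close>

text \<open>As \<open>p\<close> is a unit modulo \<open>q\<close>, the map
  \<open>i \<mapsto> p * i + m\<close> permutes the residues; on a finite set injectivity is
  enough.\<close>

lemma sum_residues:
  fixes g :: "int \<Rightarrow> 'a::comm_monoid_add" and p m :: int
  assumes q: "0 < q" and pq: "coprime p (int q)"
  shows "(\<Sum>i<q. g ((p * int i + m) mod int q)) = (\<Sum>i<q. g (int i))"
proof -
  define f where "f i = nat ((p * int i + m) mod int q)" for i
  have f: "int (f i) = (p * int i + m) mod int q" for i
    using q by (simp add: f_def)
  have "inj_on f {..<q}"
  proof (rule inj_onI)
    fix i j assume ij: "i \<in> {..<q}" "j \<in> {..<q}" "f i = f j"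
    then have "[p * int i + m = p * int j + m] (mod int q)"
      using f[of i] f[of j] by (simp add: cong_def)
    then have "[int i = int j] (mod int q)"
      using pq by (simp add: cong_add_rcancel cong_mult_lcancel)
    then show "i = j"
      using ij by (simp add: cong_def)
  qed
  moreover have "f ` {..<q} \<subseteq> {..<q}"
  proof
    fix k assume "k \<in> f ` {..<q}"
    then obtain i where "int k = (p * int i + m) mod int q" using f by auto
    then show "k \<in> {..<q}" using q by (metis lessThan_iff of_nat_0_less_iff of_nat_less_iff pos_mod_bound)
  qed
  ultimately have "bij_betw f {..<q} {..<q}"
    by (simp add: bij_betw_def endo_inj_surj)
  then have "(\<Sum>i<q. g (int (f i))) = (\<Sum>i<q. g (int i))"
    by (rule sum.reindex_bij_betw)
  then show ?thesis by (simp add: f)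
qed

lemma frac_divide:
  fixes z :: real
  assumes q: "0 < q"
  shows "frac (z / real q) = (real_of_int (\<lfloor>z\<rfloor> mod int q) + frac z) / real q"
proof -
  have *: "z = real q * of_int (\<lfloor>z\<rfloor> div int q) + (of_int (\<lfloor>z\<rfloor> mod int q) + frac z)"
  proof -
    have "real_of_int \<lfloor>z\<rfloor> = of_int (int q * (\<lfloor>z\<rfloor> div int q) + \<lfloor>z\<rfloor> mod int q)" by simp
    then have "real_of_int \<lfloor>z\<rfloor> = real q * of_int (\<lfloor>z\<rfloor> div int q) + of_int (\<lfloor>z\<rfloor> mod int q)"
      unfolding of_int_add of_int_mult of_int_of_nat_eq .
    then show ?thesis unfolding frac_def by linarith
  qed
  \<comment> \<open>An integer residue is at most \<open>q - 1\<close>, so adding a fractional part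
    stays below \<open>q\<close>.\<close>
  have "\<lfloor>z\<rfloor> mod int q \<le> int q - 1" using q by (simp add: zle_diff1_eq)
  then have "real_of_int (\<lfloor>z\<rfloor> mod int q) \<le> real q - 1"
    by (metis of_int_1 of_int_diff of_int_le_iff of_int_of_nat_eq)
  then have lt: "real_of_int (\<lfloor>z\<rfloor> mod int q) + frac z < real q"
    using frac_lt_1[of z] by linarith
  have ge: "0 \<le> real_of_int (\<lfloor>z\<rfloor> mod int q) + frac z" using q by simp
  have e: "z / real q - (of_int (\<lfloor>z\<rfloor> mod int q) + frac z) / real q = of_int (\<lfloor>z\<rfloor> div int q)"
    using q by (subst *) (simp add: field_simps)
  show ?thesis
    using q ge lt unfolding frac_unique_iff e by auto
qed

text \<open>The floor of \<open>n * y + k\<close> runs through all residues modulo \<open>n\<close>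
  as \<open>k\<close> does. Averaging over shifts by \<open>k / n\<close> thus produces a uniform
  integer summand. The general codomain of \<open>g\<close> allows the lemma to be applied to nested
  sums.\<close>

lemma sum_frac_shift:
  fixes g :: "real \<Rightarrow> 'a::comm_monoid_add"
  assumes n: "0 < n"
  shows "(\<Sum>k<n. g (real n * frac (y + real k / real n))) = (\<Sum>k<n. g (frac (real n * y) + real k))"
proof -
  have "real n * frac (y + real k / real n)
      = frac (real n * y) + of_int ((1 * int k + \<lfloor>real n * y\<rfloor>) mod int n)" for k
  proof -
    have "y + real k / real n = (real n * y + real k) / real n" using n by (simp add: field_simps)
    moreover have "\<lfloor>real n * y + real k\<rfloor> = \<lfloor>real n * y\<rfloor> + int k"
      by (metis floor_add_int of_int_of_nat_eq)
    moreover have "frac (real n * y + real k) = frac (real n * y)"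
      by (simp add: frac_def)
    ultimately show ?thesis using n
      by (simp add: frac_divide add.commute)
  qed
  then show ?thesis
    using sum_residues[OF n, where p = 1 and m = "\<lfloor>real n * y\<rfloor>" and g = "\<lambda>i. g (frac (real n * y) + of_int i)"]
    by simp
qed

text \<open>The range splits into \<open>c\<close> blocks of length \<open>q\<close>. Each block
  meets every residue once and contributes \<open>(0 + ... + (q - 1)) / q + frac t\<close>.\<close>

lemma sum_frac_arith_progression:
  fixes p :: int and t :: real
  assumes q: "0 < q" and pq: "coprime p (int q)"
  shows "(\<Sum>i<c * q. frac ((of_int p * real i + t) / real q)) = real c * ((real q - 1) / 2 + frac t)"
proof (induction c)
  case 0
  show ?case by simp
next
  case (Suc c)
  have period: "frac ((of_int p * real (i + c * q) + t) / real q)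
      = (of_int ((p * int i + \<lfloor>t\<rfloor>) mod int q) + frac t) / real q" for i
  proof -
    have "(of_int p * real (i + c * q) + t) / real q = (of_int (p * int i) + t) / real q + of_int (p * int c)"
      using q by (simp add: field_simps)
    moreover have "frac (of_int (p * int i) + t) = frac t" "\<lfloor>of_int (p * int i) + t\<rfloor> = p * int i + \<lfloor>t\<rfloor>"
      by (simp_all add: frac_def del: of_int_mult)
    ultimately show ?thesis
      using q by (simp add: frac_divide del: of_int_mult)
  qed
  have gauss: "(\<Sum>i<q. real i) = real q * (real q - 1) / 2"
    by (induction q) (simp_all add: field_simps)
  have split: "(\<Sum>i<m + n. f i) = (\<Sum>i<m. f i) + (\<Sum>i<n. f (i + m))" for f :: "nat \<Rightarrow> real" and m n
    by (induction n) (simp_all add: add_ac)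
  have "(\<Sum>i<Suc c * q. frac ((of_int p * real i + t) / real q))
      = (\<Sum>i<c * q. frac ((of_int p * real i + t) / real q))
        + (\<Sum>i<q. frac ((of_int p * real (i + c * q) + t) / real q))"
    using split[of _ "c * q" q] by (simp add: add.commute)
  also have "(\<Sum>i<q. frac ((of_int p * real (i + c * q) + t) / real q))
      = (\<Sum>i<q. (of_int (int i) + frac t) / real q)"
    unfolding period
    using sum_residues[OF q pq, where m = "\<lfloor>t\<rfloor>" and g = "\<lambda>i. (of_int i + frac t) / real q"] .
  also have "\<dots> = (real q - 1) / 2 + frac t"
    using q by (simp add: sum_divide_distrib[symmetric] sum.distrib gauss field_simps)
  finally show ?case unfolding Suc.IH by (simp only: of_nat_Suc distrib_right mult_1_left add.commute)
qed

text \<open>In lowest terms \<alpha> / H is p / q with H = c * q, so the sum covers exactly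
  \<open>c\<close> full periods.\<close>

lemma sum_frac_gcd:
  fixes \<alpha> :: int and \<xi> \<theta> :: real
  assumes H: "0 < H"
  defines "c \<equiv> gcd \<alpha> (int H)"
  shows "(\<Sum>i<H. frac (\<xi> + of_int \<alpha> * (real i + \<theta>) / real H))
    = (real H - of_int c) / 2 + of_int c * frac ((real H * \<xi> + of_int \<alpha> * \<theta>) / of_int c)"
proof -
  have c: "0 < c" using H by (simp add: c_def)
  obtain p q' where p: "\<alpha> = c * p" and q': "int H = c * q'" and cop: "coprime p q'"
    using gcd_coprime_exists[of \<alpha> "int H"] c unfolding c_def by (metis less_irrefl mult.commute)
  have "0 < q'" using q' c H by (metis of_nat_0_less_iff zero_less_mult_pos)
  then obtain q where q: "q' = int q" "0 < q" by (metis of_nat_0_less_iff zero_less_imp_eq_int)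
  obtain k where k: "c = int k" "0 < k" using c by (metis of_nat_0_less_iff zero_less_imp_eq_int)
  have Hk: "H = k * q" using q' q k by (metis of_nat_eq_iff of_nat_mult)
  have "\<xi> + of_int \<alpha> * (real i + \<theta>) / real H = (of_int p * real i + (real q * \<xi> + of_int p * \<theta>)) / real q" for i
    using q k by (simp add: p Hk field_simps)
  moreover have "(real H * \<xi> + of_int \<alpha> * \<theta>) / of_int c = real q * \<xi> + of_int p * \<theta>"
    using k by (simp add: p Hk field_simps)
  ultimately show ?thesis
    using sum_frac_arith_progression[of q p "real q * \<xi> + of_int p * \<theta>" k] q cop
    by (simp add: Hk k algebra_simps diff_divide_distrib add_divide_distrib)
qed

subsection \<open>Periodic functions on the unit cube\<close>

abbreviation (input) unit_cube :: "(real^'n) measure" where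
  "unit_cube \<equiv> uniform_measure lborel (cbox 0 1)"

text \<open>A fundamental domain for integer translations: pieces cut off and moved by a period fit
  back without overlap. It differs from the closed cube by a null set.\<close>

definition half_open_cube :: "(real^'n) set" where
  "half_open_cube = {x. \<forall>i. 0 \<le> x $ i \<and> x $ i < 1}"

lemma half_open_cube_measurable [measurable]: "half_open_cube \<in> sets borel"
  unfolding half_open_cube_def by measurable

lemma AE_inner_neq:
  fixes n :: "'a::euclidean_space"
  assumes "n \<noteq> 0"
  shows "AE x in lborel. n \<bullet> x \<noteq> r"
proof (rule AE_I')
  have "negligible {x. n \<bullet> x = r}"
    using assms by (intro negligible_hyperplane) simp
  then have "{x. n \<bullet> x = r} \<in> null_sets lebesgue"
    by (simp add: negligible_iff_null_sets)
  then show "{x. n \<bullet> x = r} \<in> null_sets lborel"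
    by (simp add: null_sets_completion_iff)
qed auto

text \<open>The exceptional set is a countable union of parallel hyperplanes. Such sets collect the
  positions that the counting formula excludes.\<close>

lemma AE_inner_notin_Ints:
  fixes n :: "'a::euclidean_space"
  assumes "n \<noteq> 0"
  shows "AE x in lborel. n \<bullet> x \<notin> \<int>"
proof -
  have "AE x in lborel. \<forall>k::int. n \<bullet> x \<noteq> of_int k"
    unfolding AE_all_countable using AE_inner_neq[OF assms] by blast
  then show ?thesis by eventually_elim (auto elim!: Ints_cases)
qed

lemma emeasure_cbox_0_1: "emeasure lborel (cbox 0 (1::real^'n)) = 1"
  by (subst emeasure_lborel_cbox_eq) (auto simp: Basis_vec_def inner_axis intro!: prod.neutral)

lemma prob_space_unit_cube: "prob_space (unit_cube :: (real^'n) measure)"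
  by (rule prob_space_uniform_measure) (simp_all add: emeasure_cbox_0_1)

lemma AE_unit_cubeI: "AE x in lborel. P x \<Longrightarrow> AE x in (unit_cube :: (real^'n) measure). P x"
  by (rule AE_uniform_measureI) (auto elim: eventually_mono)

lemma nn_integral_unit_cube_cbox:
  fixes h :: "real^'n \<Rightarrow> ennreal"
  assumes "h \<in> borel_measurable borel"
  shows "(\<integral>\<^sup>+x. h x \<partial>unit_cube) = (\<integral>\<^sup>+x. h x * indicator (cbox 0 1) x \<partial>lborel)"
  using assms by (simp add: nn_integral_uniform_measure emeasure_cbox_0_1 divide_ennreal_def)

lemma nn_integral_unit_cube:
  fixes h :: "real^'n \<Rightarrow> ennreal"
  assumes [measurable]: "h \<in> borel_measurable borel"
  shows "(\<integral>\<^sup>+x. h x \<partial>unit_cube) = (\<integral>\<^sup>+x. h x * indicator half_open_cube x \<partial>lborel)"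
proof -
  have "(\<integral>\<^sup>+x. h x \<partial>unit_cube) = (\<integral>\<^sup>+x. h x * indicator (cbox 0 1) x \<partial>lborel)"
    by (simp add: nn_integral_unit_cube_cbox)
  also have "\<dots> = (\<integral>\<^sup>+x. h x * indicator half_open_cube x \<partial>lborel)"
  proof (rule nn_integral_cong_AE)
    have "AE x in lborel. \<forall>i. axis i 1 \<bullet> (x :: real^'n) \<noteq> 1"
      unfolding AE_all_countable by (intro allI AE_inner_neq) simp
    then show "AE x in lborel. h x * indicator (cbox 0 1) x = h x * indicator half_open_cube x"
      by eventually_elim
        (auto simp: half_open_cube_def mem_box_cart inner_axis' order_less_le split: split_indicator)
  qed
  finally show ?thesis .
qed

lemma nn_integral_lborel_translate:
  fixes h :: "'a::euclidean_space \<Rightarrow> ennreal"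
  assumes [measurable]: "h \<in> borel_measurable borel"
  shows "(\<integral>\<^sup>+x. h (x + s) \<partial>lborel) = (\<integral>\<^sup>+x. h x \<partial>lborel)"
proof -
  have "(\<integral>\<^sup>+x. h x \<partial>lborel) = (\<integral>\<^sup>+x. h x \<partial>distr lborel borel ((+) s))"
    by (simp add: lborel_distr_plus)
  also have "\<dots> = (\<integral>\<^sup>+x. h (x + s) \<partial>lborel)"
    by (subst nn_integral_distr) (simp_all add: add.commute)
  finally show ?thesis by simp
qed

definition unit_periodic :: "(real^'n \<Rightarrow> 'b) \<Rightarrow> bool" where
  "unit_periodic h \<longleftrightarrow> (\<forall>x i. h (x + axis i 1) = h x)"

lemma unit_periodic_int:
  fixes h :: "real^'n \<Rightarrow> 'b"
  assumes h: "unit_periodic h"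
  shows "h (x + of_int k *\<^sub>R axis i 1) = h x"
proof (induction k arbitrary: x rule: int_induct[where k = 0])
  case base
  show ?case by simp
next
  case (step1 k)
  have "h (x + of_int (k + 1) *\<^sub>R axis i 1) = h ((x + of_int k *\<^sub>R axis i 1) + axis i 1)"
    by (simp add: algebra_simps)
  with step1 h show ?case by (simp add: unit_periodic_def)
next
  case (step2 k)
  have "h (x + of_int (k - 1) *\<^sub>R axis i 1) = h ((x + of_int (k - 1) *\<^sub>R axis i 1) + axis i 1)"
    using h by (simp add: unit_periodic_def)
  also have "\<dots> = h (x + of_int k *\<^sub>R axis i 1)"
    by (simp add: algebra_simps)
  finally show ?case using step2 by simp
qed

text \<open>Shifting by \<open>t = frac r\<close> moves the side [0, 1) to [t, 1 + t). The part
  beyond 1, moved back by one period, fills the gap [0, t).\<close>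

lemma nn_integral_unit_cube_shift_axis:
  fixes h :: "real^'n \<Rightarrow> ennreal"
  assumes [measurable]: "h \<in> borel_measurable borel" and h: "unit_periodic h"
  shows "(\<integral>\<^sup>+x. h (x + r *\<^sub>R axis i 1) \<partial>unit_cube) = (\<integral>\<^sup>+x. h x \<partial>unit_cube)"
proof -
  define t where "t = frac r"
  have t: "0 \<le> t" "t < 1" by (simp_all add: t_def frac_lt_1)
  define e :: "real^'n" where "e = axis i 1"
  \<comment> \<open>The half-open unit box with its \<open>i\<close>-th side replaced by [a,
    b).\<close>
  define Q where "Q a b = {x::real^'n. (\<forall>j. j \<noteq> i \<longrightarrow> 0 \<le> x $ j \<and> x $ j < 1) \<and> a \<le> x $ i \<and> x $ i < b}" for a b
  have Q[measurable]: "Q a b \<in> sets borel" for a b unfolding Q_def by measurable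
  have e: "e $ j = (if j = i then 1 else 0)" for j by (simp add: e_def axis_def)
  have shift: "indicator (Q a b) x = (indicator (Q (a + u) (b + u)) (x + u *\<^sub>R e) :: ennreal)" for a b u x
    by (auto simp: Q_def e split: split_indicator)
  have *: "(\<integral>\<^sup>+x. h (x + u *\<^sub>R e) * indicator (Q a b) x \<partial>lborel) = (\<integral>\<^sup>+x. h x * indicator (Q (a + u) (b + u)) x \<partial>lborel)" for a b u
    unfolding shift[of a b _ u]
    using nn_integral_lborel_translate[of "\<lambda>x. h x * indicator (Q (a + u) (b + u)) x" "u *\<^sub>R e"] by simp
  have split: "(\<integral>\<^sup>+x. h x * indicator (Q a b) x \<partial>lborel) + (\<integral>\<^sup>+x. h x * indicator (Q b c) x \<partial>lborel)
      = (\<integral>\<^sup>+x. h x * indicator (Q a c) x \<partial>lborel)" if "a \<le> b" "b \<le> c" for a b c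
    using that by (subst nn_integral_add[symmetric])
      (auto intro!: nn_integral_cong simp: Q_def split: split_indicator)
  have per: "h (x + e) = h x" for x using h by (simp add: unit_periodic_def e_def)
  have cube: "half_open_cube = Q 0 1" by (auto simp: half_open_cube_def Q_def)
  \<comment> \<open>Periodicity removes the integer part of \<open>r\<close>.\<close>
  have "h (x + r *\<^sub>R e) = h (x + t *\<^sub>R e)" for x
    using unit_periodic_int[OF h, of "x + t *\<^sub>R e" "\<lfloor>r\<rfloor>" i]
    by (simp add: t_def frac_def e_def algebra_simps)
  then have "(\<integral>\<^sup>+x. h (x + r *\<^sub>R e) \<partial>unit_cube) = (\<integral>\<^sup>+x. h (x + t *\<^sub>R e) * indicator (Q 0 1) x \<partial>lborel)"
    by (subst nn_integral_unit_cube) (simp_all add: cube)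
  also have "\<dots> = (\<integral>\<^sup>+x. h x * indicator (Q t (1 + t)) x \<partial>lborel)"
    by (subst *) simp
  also have "\<dots> = (\<integral>\<^sup>+x. h x * indicator (Q t 1) x \<partial>lborel) + (\<integral>\<^sup>+x. h x * indicator (Q 1 (1 + t)) x \<partial>lborel)"
    using t by (subst split) auto
  also have "(\<integral>\<^sup>+x. h x * indicator (Q 1 (1 + t)) x \<partial>lborel) = (\<integral>\<^sup>+x. h x * indicator (Q 0 t) x \<partial>lborel)"
    using *[of 1 0 t] per by (simp add: add.commute)
  also have "(\<integral>\<^sup>+x. h x * indicator (Q t 1) x \<partial>lborel) + \<dots> = (\<integral>\<^sup>+x. h x * indicator (Q 0 1) x \<partial>lborel)"
    using t by (subst add.commute, subst split) auto
  also have "\<dots> = (\<integral>\<^sup>+x. h x \<partial>unit_cube)"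
    by (simp add: nn_integral_unit_cube cube)
  finally show ?thesis by (simp add: e_def)
qed

text \<open>The axis components of \<open>s\<close> are added one at a time; a translate of a
  periodic function is again periodic, so the one-axis case applies at every stage.\<close>

lemma nn_integral_unit_cube_shift:
  fixes h :: "real^'n \<Rightarrow> ennreal"
  assumes h: "h \<in> borel_measurable borel" "unit_periodic h"
  shows "(\<integral>\<^sup>+x. h (x + s) \<partial>unit_cube) = (\<integral>\<^sup>+x. h x \<partial>unit_cube)"
proof -
  have "(\<integral>\<^sup>+x. h (x + (\<Sum>i\<in>I. s $ i *\<^sub>R axis i 1)) \<partial>unit_cube) = (\<integral>\<^sup>+x. h x \<partial>unit_cube)" for I
  proof (induction I rule: infinite_finite_induct)
    case (insert i I)
    let ?v = "\<Sum>i\<in>I. s $ i *\<^sub>R axis i 1"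
    have "(\<integral>\<^sup>+x. h (x + ?v + s $ i *\<^sub>R axis i 1) \<partial>unit_cube) = (\<integral>\<^sup>+x. h (x + ?v) \<partial>unit_cube)"
    proof -
      have "unit_periodic (\<lambda>x. h (x + ?v))"
      proof -
        have "x + axis j 1 + ?v = x + ?v + axis j 1" for x j by (simp add: add_ac)
        then show ?thesis
          unfolding unit_periodic_def by (simp only: \<open>\<And>j x. x + axis j 1 + ?v = x + ?v + axis j 1\<close> h(2)[unfolded unit_periodic_def, rule_format] simp_thms)
      qed
      then show ?thesis
        using nn_integral_unit_cube_shift_axis[of "\<lambda>x. h (x + ?v)" "s $ i" i] h(1)
        by (simp add: add_ac)
    qed
    then show ?case using insert by (simp add: add_ac)
  qed simp_all
  from this[of UNIV] show ?thesis
    using basis_expansion[of s] by (simp add: scalar_mult_eq_scaleR)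
qed

text \<open>The map \<open>x \<mapsto> 1 - x\<close> preserves Lebesgue measure and the closed cube,
  and \<open>1 - x\<close> differs from \<open>- x\<close> by an integer vector. The closed cube is
  used because the half-open one is not symmetric.\<close>

lemma nn_integral_unit_cube_uminus:
  fixes h :: "real^'n \<Rightarrow> ennreal"
  assumes [measurable]: "h \<in> borel_measurable borel" and h: "unit_periodic h"
  shows "(\<integral>\<^sup>+x. h (- x) \<partial>unit_cube) = (\<integral>\<^sup>+x. h x \<partial>unit_cube)"
proof -
  have lb: "lborel = distr lborel borel (\<lambda>x::real^'n. 1 - x)"
    using lborel_affine[of "-1" "1 :: real^'n"] by (simp add: density_1)
  have "(\<integral>\<^sup>+x. h x \<partial>unit_cube) = (\<integral>\<^sup>+x. h x * indicator (cbox 0 1) x \<partial>lborel)"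
    by (simp add: nn_integral_unit_cube_cbox)
  also have "\<dots> = (\<integral>\<^sup>+x. h (1 - x) * indicator (cbox 0 1) (1 - x) \<partial>lborel)"
    by (subst lb, subst nn_integral_distr) auto
  also have "\<dots> = (\<integral>\<^sup>+x. h (- x + 1) * indicator (cbox 0 1) x \<partial>lborel)"
    by (intro nn_integral_cong) (auto simp: mem_box_cart add.commute split: split_indicator)
  also have "\<dots> = (\<integral>\<^sup>+x. h (- (x + (- 1))) \<partial>unit_cube)"
    by (subst nn_integral_unit_cube_cbox) (simp_all add: add.commute)
  also have "\<dots> = (\<integral>\<^sup>+x. h (- x) \<partial>unit_cube)"
  proof (rule nn_integral_unit_cube_shift[where h = "\<lambda>x. h (- x)"])
    show "unit_periodic (\<lambda>x. h (- x))"
    proof -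
      have "h (- x) = h (- (x + axis i 1) + axis i 1)" for x i by simp
      then show ?thesis using h by (simp only: unit_periodic_def) simp
    qed
  qed measurable
  finally show ?thesis ..
qed

subsection \<open>Lattice points in a translated triangle\<close>

text \<open>For non-integral \<open>l\<close> the count is the difference of the two floors, also
  when the interval contains no integer.\<close>

lemma card_ceiling_floor:
  fixes l r :: real
  assumes "l \<le> r" "l \<notin> \<int>"
  shows "real (card {\<lceil>l\<rceil>..\<lfloor>r\<rfloor>}) = r - l - frac r + frac l"
proof -
  have c: "\<lceil>l\<rceil> = \<lfloor>l\<rfloor> + 1" using assms(2) by (simp add: ceiling_altdef) (metis Ints_of_int)
  have "\<lfloor>l\<rfloor> \<le> \<lfloor>r\<rfloor>" using assms(1) by (rule floor_mono)
  then have "real (card {\<lceil>l\<rceil>..\<lfloor>r\<rfloor>}) = of_int (\<lfloor>r\<rfloor> - \<lfloor>l\<rfloor>)"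
    by (simp add: c)
  then show ?thesis by (simp add: frac_def)
qed

text \<open>The model case: the triangle (0, 0), (a, 0), (\<alpha>, H) translated by (\<xi>,
  \<eta>), where \<open>b\<close> and \<open>c\<close> are the affine lengths of the two slanted
  sides. Each horizontal row contributes its length, corrected by the fractional parts of its
  endpoints. The signs are arranged so that the three arguments of \<open>frac\<close>, weighted by
  \<open>a\<close>, \<open>b\<close>, \<open>c\<close>, add up to 0.\<close>

lemma card_lattice_points_triangle:
  fixes \<alpha> :: int and \<xi> \<eta> :: real and a H :: nat
  assumes H: "0 < H" and \<eta>: "\<eta> \<notin> \<int>"
  defines "b \<equiv> gcd (\<alpha> - int a) (int H)" and "c \<equiv> gcd \<alpha> (int H)"
  assumes \<zeta>: "((of_int \<alpha> - real a) * \<eta> - real H * \<xi>) / of_int b \<notin> \<int>"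
    and \<omega>: "(real H * \<xi> - of_int \<alpha> * \<eta>) / of_int c \<notin> \<int>"
  shows "real (card {(s::int, j::int). 0 \<le> of_int j - \<eta> \<and> of_int j - \<eta> \<le> real H \<and>
        of_int \<alpha> * (of_int j - \<eta>) \<le> real H * (of_int s - \<xi>) \<and>
        real H * (of_int s - \<xi>) \<le> real a * real H + (of_int \<alpha> - real a) * (of_int j - \<eta>)})
    = (real a * (real H - 1) - of_int b - of_int c) / 2 + real a * frac \<eta>
      + of_int b * frac (((of_int \<alpha> - real a) * \<eta> - real H * \<xi>) / of_int b)
      + of_int c * frac ((real H * \<xi> - of_int \<alpha> * \<eta>) / of_int c)" (is "real (card ?S) = _")
proof -
  \<comment> \<open>The height of the first integer row above the base. Since 0 < \<theta> < 1,
    exactly \<open>H\<close> rows meet the triangle, at heights \<open>i + \<theta>\<close> for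
    \<open>i < H\<close>.\<close>
  define \<theta> where "\<theta> = 1 - frac \<eta>"
  have \<theta>: "0 < \<theta>" "\<theta> < 1"
    using \<eta> by (simp_all add: \<theta>_def frac_lt_1 frac_gt_0_iff)
  have b: "0 < b" and c: "0 < c" using H by (simp_all add: b_def c_def)
  \<comment> \<open>The ends of row \<open>i\<close>, on the edges that join (0, 0) and (a, 0) to
    the apex.\<close>
  define l where "l i = \<xi> + of_int \<alpha> * (real i + \<theta>) / real H" for i
  define r where "r i = real a + (\<xi> + of_int (\<alpha> - int a) * (real i + \<theta>) / real H)" for i
  define f where "f = (\<lambda>(i::nat, s::int). (s, \<lfloor>\<eta>\<rfloor> + 1 + int i))"
  have j: "of_int (\<lfloor>\<eta>\<rfloor> + 1 + int i) - \<eta> = real i + \<theta>" for i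
    by (simp add: \<theta>_def frac_def)
  have S: "?S = f ` (SIGMA i:{..<H}. {\<lceil>l i\<rceil>..\<lfloor>r i\<rfloor>})"
  proof -
    have slice: "s \<in> {\<lceil>l i\<rceil>..\<lfloor>r i\<rfloor>} \<longleftrightarrow>
      of_int \<alpha> * (real i + \<theta>) \<le> real H * (of_int s - \<xi>) \<and>
      real H * (of_int s - \<xi>) \<le> real a * real H + (of_int \<alpha> - real a) * (real i + \<theta>)" for s i
    proof -
      have "s \<in> {\<lceil>l i\<rceil>..\<lfloor>r i\<rfloor>} \<longleftrightarrow> l i \<le> of_int s \<and> of_int s \<le> r i"
        by (simp add: ceiling_le_iff le_floor_iff)
      also have "\<dots> \<longleftrightarrow> of_int \<alpha> * (real i + \<theta>) / real H \<le> of_int s - \<xi> \<and>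
          of_int s - \<xi> - real a \<le> (of_int \<alpha> - real a) * (real i + \<theta>) / real H"
        by (auto simp: l_def r_def)
      also have "\<dots> \<longleftrightarrow> of_int \<alpha> * (real i + \<theta>) \<le> real H * (of_int s - \<xi>) \<and>
          real H * (of_int s - \<xi> - real a) \<le> (of_int \<alpha> - real a) * (real i + \<theta>)"
        using H by (simp add: pos_le_divide_eq pos_divide_le_eq mult.commute)
      also have "real H * (of_int s - \<xi> - real a) = real H * (of_int s - \<xi>) - real a * real H"
        by (simp add: algebra_simps)
      finally show ?thesis unfolding diff_le_eq[of _ "real a * real H"] by (simp only: add.commute)
    qed
    show ?thesis
    proof (intro equalityI subsetI)
      fix p assume "p \<in> ?S"
      then obtain s j where p: "p = (s, j)" and j0: "0 \<le> of_int j - \<eta>" and jH: "of_int j - \<eta> \<le> real H"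
        and st: "of_int \<alpha> * (of_int j - \<eta>) \<le> real H * (of_int s - \<xi>)"
          "real H * (of_int s - \<xi>) \<le> real a * real H + (of_int \<alpha> - real a) * (of_int j - \<eta>)"
        by auto
      define i where "i = nat (j - \<lfloor>\<eta>\<rfloor> - 1)"
      have "of_int j \<noteq> \<eta>" using \<eta> by auto
      then have "\<lfloor>\<eta>\<rfloor> < j" using j0 by linarith
      then have ji: "j = \<lfloor>\<eta>\<rfloor> + 1 + int i" by (simp add: i_def)
      have "real i < real H" using jH j[of i] \<theta> unfolding ji by linarith
      then have "i < H" by simp
      moreover have "s \<in> {\<lceil>l i\<rceil>..\<lfloor>r i\<rfloor>}"
        using st unfolding slice ji j by simp
      ultimately show "p \<in> f ` (SIGMA i:{..<H}. {\<lceil>l i\<rceil>..\<lfloor>r i\<rfloor>})"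
        by (auto simp: f_def p ji intro!: image_eqI[where x = "(i, s)"])
    next
      fix p assume "p \<in> f ` (SIGMA i:{..<H}. {\<lceil>l i\<rceil>..\<lfloor>r i\<rfloor>})"
      then obtain i s where p: "p = (s, \<lfloor>\<eta>\<rfloor> + 1 + int i)" and i: "i < H" and s: "s \<in> {\<lceil>l i\<rceil>..\<lfloor>r i\<rfloor>}"
        by (auto simp: f_def)
      have "real i + 1 \<le> real H" using i by linarith
      then have "0 \<le> real i + \<theta>" "real i + \<theta> \<le> real H" using \<theta> by linarith+
      then show "p \<in> ?S" using s unfolding slice p by (simp only: mem_Collect_eq case_prod_conv j simp_thms)
    qed
  qed
  have "inj_on f (SIGMA i:{..<H}. {\<lceil>l i\<rceil>..\<lfloor>r i\<rfloor>})" by (auto simp: f_def inj_on_def)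
  then have "real (card ?S) = (\<Sum>i<H. real (card {\<lceil>l i\<rceil>..\<lfloor>r i\<rfloor>}))"
    unfolding S by (simp add: card_image card_SigmaI del: card_atLeastAtMost_int)
  also have "\<dots> = (\<Sum>i<H. r i - l i - frac (r i) + frac (l i))"
  proof (rule sum.cong)
    fix i assume "i \<in> {..<H}"
    then have "real i + 1 \<le> real H" by auto
    then have "real i + \<theta> \<le> real H" using \<theta> by linarith
    then have "(real i + \<theta>) / real H \<le> 1" using H by simp
    then have "real a * ((real i + \<theta>) / real H) \<le> real a"
      by (metis mult_left_mono mult.right_neutral of_nat_0_le_iff)
    then have "l i \<le> r i" by (simp add: l_def r_def left_diff_distrib diff_divide_distrib)
    \<comment> \<open>With \<open>q = H / c\<close> and \<open>p = \<alpha> / c\<close>, an integral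
      \<open>l i\<close> would make the argument in assumption \<omega> an integer combination of
      integers.\<close>
    moreover have "l i \<notin> \<int>"
    proof
      assume "l i \<in> \<int>"
      obtain p q where p: "\<alpha> = c * p" and q: "int H = c * q"
        unfolding c_def by (meson gcd_dvd1 gcd_dvd2 dvdE)
      have qH: "real H = of_int c * of_int q" using q by (metis of_int_mult of_int_of_nat_eq)
      have q0: "q \<noteq> 0" using q H by auto
      have lq: "of_int q * l i = of_int q * \<xi> + of_int p * (real i + \<theta>)"
        using c q0 by (simp add: l_def qH p field_simps)
      have "(real H * \<xi> - of_int \<alpha> * \<eta>) / of_int c = of_int q * \<xi> - of_int p * \<eta>"
        using c by (simp add: qH p field_simps)
      also have "\<dots> = of_int q * l i - of_int p * of_int (\<lfloor>\<eta>\<rfloor> + 1 + int i)"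
        unfolding lq j[symmetric] by (simp add: algebra_simps)
      also have "\<dots> \<in> \<int>" using \<open>l i \<in> \<int>\<close> by (intro Ints_diff Ints_mult Ints_of_int)
      finally show False using \<omega> by simp
    qed
    ultimately show "real (card {\<lceil>l i\<rceil>..\<lfloor>r i\<rfloor>}) = r i - l i - frac (r i) + frac (l i)"
      by (rule card_ceiling_floor)
  qed simp
  also have "\<dots> = (\<Sum>i<H. r i - l i) - (\<Sum>i<H. frac (r i)) + (\<Sum>i<H. frac (l i))"
    by (simp add: sum.distrib sum_subtractf)
  \<comment> \<open>The row lengths form an arithmetic progression; the offset \<theta> of the first
    row yields the term \<open>real a * frac \<eta>\<close>.\<close>
  also have "(\<Sum>i<H. r i - l i) = real a * (real H - 1) / 2 + real a * frac \<eta>"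
  proof -
    have gauss: "(\<Sum>i<n. real i + \<theta>) = real n * (real n - 1) / 2 + real n * \<theta>" for n
      by (induction n) (simp_all add: field_simps)
    have "(\<Sum>i<H. r i - l i) = (\<Sum>i<H. real a - real a / real H * (real i + \<theta>))"
      by (simp add: l_def r_def left_diff_distrib diff_divide_distrib)
    also have "\<dots> = real a * real H - real a / real H * (\<Sum>i<H. real i + \<theta>)"
      by (simp add: sum_subtractf sum_distrib_left)
    also have "\<dots> = real a * (real H - 1) / 2 + real a * frac \<eta>"
      unfolding gauss using H by (simp add: \<theta>_def field_simps)
    finally show ?thesis .
  qed
  also have "(\<Sum>i<H. frac (l i)) = (real H - of_int c) / 2
      + of_int c * frac ((real H * \<xi> - of_int \<alpha> * \<eta>) / of_int c)"
  proof -
    \<comment> \<open>\<theta> and -\<eta> differ by an integer, and \<open>c\<close> divides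
      \<alpha>, so exchanging them does not affect the fractional part.\<close>
    have "\<alpha> div c * c = \<alpha>" by (simp add: c_def)
    then have \<alpha>c: "of_int \<alpha> = of_int (\<alpha> div c) * of_int c" by (metis of_int_mult)
    have "(real H * \<xi> + of_int \<alpha> * \<theta>) / of_int c
        = (real H * \<xi> - of_int \<alpha> * \<eta>) / of_int c + of_int (\<alpha> div c * (\<lfloor>\<eta>\<rfloor> + 1))"
      using c by (subst (1 2) \<alpha>c) (simp add: \<theta>_def frac_def field_simps)
    then have "frac ((real H * \<xi> + of_int \<alpha> * \<theta>) / of_int c) = frac ((real H * \<xi> - of_int \<alpha> * \<eta>) / of_int c)"
      by (simp only: frac_add_of_int_right)
    then show ?thesis
      unfolding l_def using sum_frac_gcd[OF H, of \<xi> \<alpha> \<theta>] by (simp add: c_def)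
  qed
  also have "(\<Sum>i<H. frac (r i)) = (real H - of_int b) / 2
      + of_int b * (1 - frac (((of_int \<alpha> - real a) * \<eta> - real H * \<xi>) / of_int b))"
  proof -
    \<comment> \<open>The right ends enter the count with a minus sign. Negating the argument, which
      is non-integral by \<zeta>, gives \<open>1 - frac\<close> and hence a positive
      coefficient.\<close>
    define \<beta> where "\<beta> = \<alpha> - int a"
    have \<beta>: "of_int \<beta> = of_int \<alpha> - real a" by (simp add: \<beta>_def)
    have "\<beta> div b * b = \<beta>" by (simp add: b_def \<beta>_def)
    then have \<beta>b: "of_int \<beta> = of_int (\<beta> div b) * of_int b" by (metis of_int_mult)
    have "(real H * \<xi> + of_int \<beta> * \<theta>) / of_int b
        = - ((of_int \<beta> * \<eta> - real H * \<xi>) / of_int b) + of_int (\<beta> div b * (\<lfloor>\<eta>\<rfloor> + 1))"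
      using b by (subst (1 2) \<beta>b) (simp add: \<theta>_def frac_def field_simps)
    then have "frac ((real H * \<xi> + of_int \<beta> * \<theta>) / of_int b)
        = frac (- ((of_int \<beta> * \<eta> - real H * \<xi>) / of_int b))"
      by (simp only: frac_add_of_int_right)
    also have "\<dots> = 1 - frac ((of_int \<beta> * \<eta> - real H * \<xi>) / of_int b)"
      using \<zeta> by (simp add: \<beta> frac_neg)
    finally have *: "frac ((real H * \<xi> + of_int \<beta> * \<theta>) / of_int b)
        = 1 - frac ((of_int \<beta> * \<eta> - real H * \<xi>) / of_int b)" .
    have "frac (r i) = frac (\<xi> + of_int \<beta> * (real i + \<theta>) / real H)" for i
      unfolding r_def \<beta>_def by (rule frac_add_int_left) simp
    then show ?thesis
      using sum_frac_gcd[OF H, of \<xi> \<beta> \<theta>] * by (simp add: b_def \<beta> \<beta>_def[symmetric])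
  qed
  finally show ?thesis by (simp add: field_simps)
qed

section \<open>Unimodular coordinates adapted to one side\<close>

text \<open>Up to positive factors the inequalities say \<nu> \<ge> 0, \<mu> \<ge> 0 and \<mu> +
  \<nu> \<le> 1; their consequence \<open>y \<le> h\<close> is recorded to bound the rows.\<close>

lemma triangle_coordinates_iff:
  fixes x y a h \<alpha> :: real
  assumes a: "0 < a" and h: "0 < h"
  shows "(\<exists>\<mu> \<nu>. 0 \<le> \<mu> \<and> 0 \<le> \<nu> \<and> \<mu> + \<nu> \<le> 1 \<and> x = \<mu> * a + \<nu> * \<alpha> \<and> y = \<nu> * h)
    \<longleftrightarrow> 0 \<le> y \<and> y \<le> h \<and> \<alpha> * y \<le> h * x \<and> h * x \<le> a * h + (\<alpha> - a) * y" (is "?L \<longleftrightarrow> ?R")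
proof
  assume ?L
  then obtain \<mu> \<nu> where n: "0 \<le> \<mu>" "0 \<le> \<nu>" "\<mu> + \<nu> \<le> 1" and x: "x = \<mu> * a + \<nu> * \<alpha>" and y: "y = \<nu> * h"
    by blast
  have "\<nu> * h \<le> 1 * h" using n h by (intro mult_right_mono) auto
  moreover have "0 \<le> a * h * \<mu>" using n a h by simp
  moreover have "0 \<le> a * h * (1 - \<mu> - \<nu>)" using n a h by simp
  ultimately show ?R using n h by (simp add: x y algebra_simps)
next
  assume R: ?R
  \<comment> \<open>Cramer's rule, with determinant \<open>a * h\<close>.\<close>
  define \<mu> where "\<mu> = (h * x - \<alpha> * y) / (a * h)"
  have "0 \<le> \<mu>" using R a h by (simp add: \<mu>_def)
  moreover have "0 \<le> y / h" using R h by simp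
  moreover have "\<mu> + y / h = (h * x - \<alpha> * y + a * y) / (a * h)"
    using a h by (simp add: \<mu>_def field_simps)
  then have "\<mu> + y / h \<le> 1"
    using R a h by (simp add: pos_divide_le_eq algebra_simps)
  moreover have "x = \<mu> * a + y / h * \<alpha>" "y = y / h * h"
    using a h by (simp_all add: \<mu>_def field_simps)
  ultimately show ?L by blast
qed

text \<open>The matrix with rows (u, v) and (-q, p) has determinant 1, so its inverse is integral
  and common divisors are preserved both ways.\<close>

lemma gcd_unimodular:
  fixes r s u v p q :: int
  assumes 1: "p * u + q * v = 1"
  shows "gcd (u * r + v * s) (p * s - q * r) = gcd r s"
proof -
  let ?g = "gcd (u * r + v * s) (p * s - q * r)"
  have rs: "r = p * (u * r + v * s) - v * (p * s - q * r)" "s = q * (u * r + v * s) + u * (p * s - q * r)"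
    using 1 by algebra+
  have "?g dvd p * (u * r + v * s) - v * (p * s - q * r)"
    by (intro dvd_diff dvd_mult gcd_dvd1 gcd_dvd2)
  moreover have "?g dvd q * (u * r + v * s) + u * (p * s - q * r)"
    by (intro dvd_add dvd_mult gcd_dvd1 gcd_dvd2)
  moreover have "gcd r s dvd ?g"
    by (intro gcd_greatest dvd_add dvd_diff dvd_mult gcd_dvd1 gcd_dvd2)
  ultimately show ?thesis unfolding rs[symmetric] by (intro zdvd_antisym_nonneg gcd_greatest) auto
qed

lemma integer_latticeE:
  assumes "P \<in> integer_lattice"
  obtains p q :: int where "P = vector [of_int p, of_int q]"
proof -
  have "P $ 1 \<in> \<int>" "P $ 2 \<in> \<int>" using assms by (auto simp: integer_lattice_def)
  then obtain p q :: int where "P $ 1 = of_int p" "P $ 2 = of_int q" by (metis Ints_cases)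
  then have "P = vector [of_int p, of_int q]" by (simp add: vec_eq_iff forall_2)
  then show ?thesis using that by blast
qed

lemma integer_lattice_diff: "P \<in> integer_lattice \<Longrightarrow> Q \<in> integer_lattice \<Longrightarrow> P - Q \<in> integer_lattice"
  by (simp add: integer_lattice_def)

lemma inner_integer_lattice: "P \<in> integer_lattice \<Longrightarrow> Q \<in> integer_lattice \<Longrightarrow> P \<bullet> Q \<in> \<int>"
  by (simp add: integer_lattice_def inner_vec_def sum_2)

lemma inner_vector_2: "vector [p, q] \<bullet> x = p * x $ 1 + q * x $ 2" for x :: "real^2"
  by (simp add: inner_vec_def sum_2)

lemma vector_2_in_integer_lattice: "vector [p, q] \<in> integer_lattice \<longleftrightarrow> p \<in> \<int> \<and> q \<in> \<int>"
  by (simp add: integer_lattice_def forall_2)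

lemma affine_length_pos:
  assumes "P \<in> integer_lattice" "Q \<in> integer_lattice" "P \<noteq> Q"
  shows "0 < affine_length P Q"
proof -
  obtain p q :: int where pq: "Q - P = vector [of_int p, of_int q]"
    using integer_latticeE integer_lattice_diff assms by metis
  have "(p, q) \<noteq> (0, 0)"
  proof
    assume "(p, q) = (0, 0)"
    with pq have "Q - P = 0" by (simp add: vec_eq_iff forall_2)
    with assms show False by simp
  qed
  then show ?thesis using affine_length_eq_gcd[OF assms(1) pq] by (simp add: gcd_pos_int)
qed

text \<open>A unimodular change of coordinates makes the side from \<open>B\<close> to
  \<open>C\<close> horizontal and reduces to the model case. The vectors \<open>n1\<close>,
  \<open>n2\<close>, \<open>n3\<close> are integral normals of the sides opposite \<open>A\<close>,
  \<open>B\<close>, \<open>C\<close>. Their weighted sum vanishes, yet \<open>n1\<close> and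
  \<open>n2\<close> are independent.\<close>

lemma lattice_count_triangle:
  fixes A B C :: "real^2"
  assumes L: "A \<in> integer_lattice" "B \<in> integer_lattice" "C \<in> integer_lattice"
    and nondegenerate: "\<not> collinear {A, B, C}"
  defines "a \<equiv> affine_length B C" and "b \<equiv> affine_length C A" and "c \<equiv> affine_length A B"
  obtains n1 n2 n3 :: "real^2" and \<kappa> :: real
  where "n1 \<in> integer_lattice" "n2 \<in> integer_lattice" "n3 \<in> integer_lattice"
    and "real a *\<^sub>R n1 + real b *\<^sub>R n2 + real c *\<^sub>R n3 = 0"
    and "\<And>y z. \<exists>s. n1 \<bullet> s = y \<and> n2 \<bullet> s = z"
    and "\<And>x. n1 \<bullet> x \<notin> \<int> \<Longrightarrow> n2 \<bullet> x \<notin> \<int> \<Longrightarrow> n3 \<bullet> x \<notin> \<int> \<Longrightarrow>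
      real (lattice_count (convex hull {A, B, C}) x)
        = \<kappa> + real a * frac (n1 \<bullet> x) + real b * frac (n2 \<bullet> x) + real c * frac (n3 \<bullet> x)"
proof -
  have ne: "B \<noteq> C" "C \<noteq> A" "A \<noteq> B"
    using nondegenerate by (auto simp: insert_commute)
  obtain p q :: int where CB: "C - B = vector [of_int p, of_int q]"
    using integer_latticeE integer_lattice_diff L by metis
  obtain r s :: int where AB: "A - B = vector [of_int r, of_int s]"
    using integer_latticeE integer_lattice_diff L by metis
  have CBi: "C $ 1 - B $ 1 = of_int p" "C $ 2 - B $ 2 = of_int q"
    using CB by (metis vector_minus_component vector_2)+
  have ABi: "A $ 1 - B $ 1 = of_int r" "A $ 2 - B $ 2 = of_int s"
    using AB by (metis vector_minus_component vector_2)+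
  have BA: "B - A = vector [of_int (- r), of_int (- s)]"
    and AC: "A - C = vector [of_int (r - p), of_int (s - q)]"
    using CBi ABi by (simp_all add: vec_eq_iff forall_2)
  have nz: "(p, q) \<noteq> (0, 0)" "(- r, - s) \<noteq> (0, 0)" "(r - p, s - q) \<noteq> (0, 0)"
    using CBi ABi ne by (auto simp: vec_eq_iff forall_2)
  have gcds: "int a = gcd p q" "int b = gcd (r - p) (s - q)" "int c = gcd r s"
    unfolding a_def b_def c_def affine_length_eq_gcd[OF L(2) CB nz(1)]
      affine_length_eq_gcd[OF L(1) BA nz(2)] affine_length_eq_gcd[OF L(3) AC nz(3)]
    by simp_all
  have pos: "0 < a" "0 < b" "0 < c"
    unfolding a_def b_def c_def using affine_length_pos L ne by blast+
  \<comment> \<open>The primitive direction of \<open>C - B\<close>; Bezout coefficients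
    \<open>u\<close>, \<open>v\<close> complete it to a lattice basis.\<close>
  obtain p' q' where p: "p = int a * p'" and q: "q = int a * q'" and cop: "coprime p' q'"
    using gcd_coprime_exists[of p q] pos(1) gcds(1)
    by (metis less_irrefl mult.commute of_nat_0_less_iff)
  obtain u v where "u * p' + v * q' = 1" using bezout_int[of p' q'] cop by auto
  then have 1: "p' * u + q' * v = 1" by (simp add: mult.commute)
  then have "real_of_int (p' * u + q' * v) = 1" by simp
  then have uv: "real_of_int p' * of_int u + of_int q' * of_int v = 1" by simp
  \<comment> \<open>\<alpha> and \<open>h\<close> are the coordinates of \<open>A - B\<close> along
    and across the side; the sign \<sigma> orients the second one so that \<open>A\<close> has
    positive height \<open>H\<close>.\<close>
  define \<alpha> where "\<alpha> = u * r + v * s"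
  define h where "h = p' * s - q' * r"
  define \<sigma> where "\<sigma> = sgn h"
  have h0: "h \<noteq> 0"
  proof
    assume "h = 0"
    then have rs: "r = \<alpha> * p'" "s = \<alpha> * q'"
      using 1 unfolding h_def \<alpha>_def by algebra+
    have "A - B = (of_int \<alpha> / real a) *\<^sub>R (C - B)"
      using pos(1) by (simp add: AB CB vec_eq_iff forall_2 rs p q)
    then have "collinear {0, A - B, C - B}"
      by (subst insert_commute, subst collinear_lemma[THEN iffD2]) (auto simp: collinear_lemma insert_commute)
    then show False using nondegenerate
      by (subst (asm) collinear_3) (auto simp: insert_commute)
  qed
  define H where "H = nat \<bar>h\<bar>"
  have H: "0 < H" "int H = \<bar>h\<bar>" using h0 by (simp_all add: H_def)
  have \<sigma>: "\<sigma> * \<sigma> = 1" "\<sigma> * h = int H" using h0 by (auto simp: \<sigma>_def H sgn_if)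
  \<comment> \<open>The coordinate change has determinant 1, so affine lengths can be read off in
    the new coordinates.\<close>
  have gb: "int b = gcd (\<alpha> - int a) (int H)"
  proof -
    have "u * (r - p) + v * (s - q) = \<alpha> - int a" "p' * (s - q) - q' * (r - p) = h"
      using 1 unfolding \<alpha>_def h_def p q by (algebra, simp add: algebra_simps)
    then show ?thesis using gcd_unimodular[OF 1, of "r - p" "s - q"] by (simp add: gcds H)
  qed
  have gc: "int c = gcd \<alpha> (int H)"
    using gcd_unimodular[OF 1, of r s] by (simp add: gcds H \<alpha>_def h_def)
  \<comment> \<open>\<open>m\<close> and \<open>n1\<close> are the coordinate forms dual to the
    lattice basis \<open>d\<close>, \<open>e\<close>. The forms \<open>n2\<close> and
    \<open>n3\<close> are those of the slanted edges in the model case, divided by \<open>b\<close>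
    and \<open>c\<close>.\<close>
  define m :: "real^2" where "m = vector [of_int u, of_int v]"
  define n1 :: "real^2" where "n1 = vector [- of_int (\<sigma> * q'), of_int (\<sigma> * p')]"
  define n2 where "n2 = (1 / real b) *\<^sub>R ((of_int \<alpha> - real a) *\<^sub>R n1 - real H *\<^sub>R m)"
  define n3 where "n3 = (1 / real c) *\<^sub>R (real H *\<^sub>R m - of_int \<alpha> *\<^sub>R n1)"
  define d :: "real^2" where "d = vector [of_int p', of_int q']"
  define e :: "real^2" where "e = vector [- of_int (\<sigma> * v), of_int (\<sigma> * u)]"
  have \<sigma>r: "real_of_int \<sigma> * of_int \<sigma> = 1" using \<sigma>(1) by (metis of_int_1 of_int_mult)
  have coords: "m \<bullet> d = 1" "m \<bullet> e = 0" "n1 \<bullet> d = 0" "n1 \<bullet> e = 1"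
    using uv \<sigma>r by (simp_all add: m_def n1_def d_def e_def inner_vector_2, algebra+)
  have expand: "x = (m \<bullet> x) *\<^sub>R d + (n1 \<bullet> x) *\<^sub>R e" for x
  proof -
    have "x $ 1 = (of_int u * x $ 1 + of_int v * x $ 2) * of_int p'
        + (of_int \<sigma> * of_int p' * x $ 2 - of_int \<sigma> * of_int q' * x $ 1) * (- (of_int \<sigma> * of_int v))"
      "x $ 2 = (of_int u * x $ 1 + of_int v * x $ 2) * of_int q'
        + (of_int \<sigma> * of_int p' * x $ 2 - of_int \<sigma> * of_int q' * x $ 1) * (of_int \<sigma> * of_int u)"
      using uv \<sigma>r by algebra+
    then show ?thesis
      by (simp add: vec_eq_iff forall_2 m_def n1_def d_def e_def inner_vector_2)
  qed
  have inL: "m \<in> integer_lattice" "n1 \<in> integer_lattice" "d \<in> integer_lattice" "e \<in> integer_lattice"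
    by (simp_all add: m_def n1_def d_def e_def vector_2_in_integer_lattice)
  \<comment> \<open>Each affine length divides both coefficients of its edge form, which makes
    \<open>n2\<close> and \<open>n3\<close> integral.\<close>
  have div_int: "(1 / real k) *\<^sub>R (of_int i *\<^sub>R x - of_int j *\<^sub>R y) \<in> integer_lattice"
    if "int k dvd i" "int k dvd j" "0 < k" "x \<in> integer_lattice" "y \<in> integer_lattice" for k i j x y
  proof -
    obtain i' j' where "i = int k * i'" "j = int k * j'"
      using \<open>int k dvd i\<close> \<open>int k dvd j\<close> unfolding dvd_def by blast
    then have "(1 / real k) *\<^sub>R (of_int i *\<^sub>R x - of_int j *\<^sub>R y) = of_int i' *\<^sub>R x - of_int j' *\<^sub>R y"
      using \<open>0 < k\<close> by (simp add: scaleR_diff_right)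
    then show ?thesis using that by (simp add: integer_lattice_def)
  qed
  have n2L: "n2 \<in> integer_lattice"
    using div_int[of b "\<alpha> - int a" "int H" n1 m] pos inL gb by (simp add: n2_def)
  have n3L: "n3 \<in> integer_lattice"
    using div_int[of c "int H" \<alpha> m n1] pos inL gc by (simp add: n3_def)
  have sides: "m \<bullet> (C - B) = real a" "n1 \<bullet> (C - B) = 0" "m \<bullet> (A - B) = of_int \<alpha>" "n1 \<bullet> (A - B) = real H"
  proof -
    have "m \<bullet> (C - B) = of_int (int a * (p' * u + q' * v))"
      by (simp add: m_def CB inner_vector_2 p q algebra_simps)
    then show "m \<bullet> (C - B) = real a" by (simp add: 1)
    show "n1 \<bullet> (C - B) = 0"
      by (simp add: n1_def CB inner_vector_2 p q algebra_simps)
    show "m \<bullet> (A - B) = of_int \<alpha>"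
      by (simp add: m_def AB inner_vector_2 \<alpha>_def)
    have "n1 \<bullet> (A - B) = of_int (\<sigma> * h)"
      by (simp add: n1_def AB inner_vector_2 h_def algebra_simps)
    then show "n1 \<bullet> (A - B) = real H" by (simp add: \<sigma>)
  qed
  have in_hull: "y \<in> convex hull {A, B, C} \<longleftrightarrow> 0 \<le> n1 \<bullet> (y - B) \<and> n1 \<bullet> (y - B) \<le> real H \<and>
      of_int \<alpha> * (n1 \<bullet> (y - B)) \<le> real H * (m \<bullet> (y - B)) \<and>
      real H * (m \<bullet> (y - B)) \<le> real a * real H + (of_int \<alpha> - real a) * (n1 \<bullet> (y - B))" for y
  proof -
    have "y = B + \<mu> *\<^sub>R (C - B) + \<nu> *\<^sub>R (A - B) \<longleftrightarrow>
        m \<bullet> (y - B) = \<mu> * real a + \<nu> * of_int \<alpha> \<and> n1 \<bullet> (y - B) = \<nu> * real H" for \<mu> \<nu>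
    proof -
      define w where "w = \<mu> *\<^sub>R (C - B) + \<nu> *\<^sub>R (A - B)"
      have w: "m \<bullet> w = \<mu> * real a + \<nu> * of_int \<alpha>" "n1 \<bullet> w = \<nu> * real H"
        by (simp_all add: w_def inner_add_right sides)
      have "y = B + \<mu> *\<^sub>R (C - B) + \<nu> *\<^sub>R (A - B) \<longleftrightarrow> y - B = w"
        by (auto simp: w_def algebra_simps)
      also have "\<dots> \<longleftrightarrow> m \<bullet> (y - B) = m \<bullet> w \<and> n1 \<bullet> (y - B) = n1 \<bullet> w"
        using expand[of "y - B"] expand[of w] by metis
      finally show ?thesis unfolding w .
    qed
    moreover have "convex hull {A, B, C} = convex hull {B, C, A}" by (simp add: insert_commute)
    ultimately have "y \<in> convex hull {A, B, C} \<longleftrightarrow> (\<exists>\<mu> \<nu>. 0 \<le> \<mu> \<and> 0 \<le> \<nu> \<and> \<mu> + \<nu> \<le> 1 \<and>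
        m \<bullet> (y - B) = \<mu> * real a + \<nu> * of_int \<alpha> \<and> n1 \<bullet> (y - B) = \<nu> * real H)"
      unfolding convex_hull_3_alt by auto
    then show ?thesis
      using triangle_coordinates_iff[of "real a" "real H" "m \<bullet> (y - B)" "of_int \<alpha>" "n1 \<bullet> (y - B)"] pos H
      by simp
  qed
  define \<kappa> where "\<kappa> = (real a * (real H - 1) - real b - real c) / 2"
  have count: "real (lattice_count (convex hull {A, B, C}) x)
      = \<kappa> + real a * frac (n1 \<bullet> x) + real b * frac (n2 \<bullet> x) + real c * frac (n3 \<bullet> x)"
    if x: "n1 \<bullet> x \<notin> \<int>" "n2 \<bullet> x \<notin> \<int>" "n3 \<bullet> x \<notin> \<int>" for x
  proof -
    \<comment> \<open>Lattice points in coordinates with origin \<open>B\<close>. The translation by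
      \<open>x\<close> enters the model case as \<xi> = \<open>m \<bullet> x\<close> and \<eta> =
      \<open>n1 \<bullet> x\<close>.\<close>
    define g where "g = (\<lambda>(i::int, j::int). B + of_int i *\<^sub>R d + of_int j *\<^sub>R e)"
    define S where "S = {(i::int, j::int). 0 \<le> of_int j - n1 \<bullet> x \<and> of_int j - n1 \<bullet> x \<le> real H \<and>
        of_int \<alpha> * (of_int j - n1 \<bullet> x) \<le> real H * (of_int i - m \<bullet> x) \<and>
        real H * (of_int i - m \<bullet> x) \<le> real a * real H + (of_int \<alpha> - real a) * (of_int j - n1 \<bullet> x)}"
    have g: "m \<bullet> (g (i, j) - x - B) = of_int i - m \<bullet> x" "n1 \<bullet> (g (i, j) - x - B) = of_int j - n1 \<bullet> x" for i j
      by (simp_all add: g_def inner_add_right inner_diff_right coords)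
    have g_iff: "g z - x \<in> convex hull {A, B, C} \<longleftrightarrow> z \<in> S" for z
      by (cases z) (simp only: in_hull g S_def mem_Collect_eq case_prod_conv)
    have "(\<lambda>t. t + x) ` (convex hull {A, B, C}) \<inter> integer_lattice = g ` S"
    proof (intro equalityI subsetI)
      fix y assume y: "y \<in> (\<lambda>t. t + x) ` (convex hull {A, B, C}) \<inter> integer_lattice"
      then have yT: "y - x \<in> convex hull {A, B, C}" by auto
      have "y - B \<in> integer_lattice" using y L by (simp add: integer_lattice_diff)
      then obtain i j where "m \<bullet> (y - B) = of_int i" "n1 \<bullet> (y - B) = of_int j"
        using inner_integer_lattice inL by (metis Ints_cases)
      then have "g (i, j) = y" using expand[of "y - B"] by (simp add: g_def algebra_simps)
      then show "y \<in> g ` S" using g_iff yT by blast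
    next
      fix y assume "y \<in> g ` S"
      then obtain i j where y: "y = g (i, j)" "(i, j) \<in> S" by auto
      have "y - x \<in> convex hull {A, B, C}" using y g_iff by simp
      then have "y \<in> (\<lambda>t. t + x) ` (convex hull {A, B, C})" by (metis diff_add_cancel image_eqI)
      moreover have "y \<in> integer_lattice"
        using L inL by (simp add: y g_def integer_lattice_def)
      ultimately show "y \<in> (\<lambda>t. t + x) ` (convex hull {A, B, C}) \<inter> integer_lattice" by simp
    qed
    moreover have "inj_on g S"
    proof (rule inj_onI)
      fix z w assume "g z = g w"
      then show "z = w"
        using g[of "fst z" "snd z"] g[of "fst w" "snd w"] by (simp add: prod_eq_iff)
    qed
    ultimately have card: "lattice_count (convex hull {A, B, C}) x = card S"
      by (simp add: lattice_count_def card_image)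
    have n23: "((of_int \<alpha> - real a) * (n1 \<bullet> x) - real H * (m \<bullet> x)) / real b = n2 \<bullet> x"
      "(real H * (m \<bullet> x) - of_int \<alpha> * (n1 \<bullet> x)) / real c = n3 \<bullet> x"
      by (simp_all add: n2_def n3_def inner_diff_left)
    show ?thesis
      using card_lattice_points_triangle[OF H(1) x(1), of \<alpha> a "m \<bullet> x"] x(2,3)
      unfolding gb[symmetric] gc[symmetric] of_int_of_nat_eq n23 card S_def \<kappa>_def by blast
  qed
  have sum0: "real a *\<^sub>R n1 + real b *\<^sub>R n2 + real c *\<^sub>R n3 = 0"
    using pos by (simp add: n2_def n3_def algebra_simps)
  have solve: "\<exists>s. n1 \<bullet> s = y \<and> n2 \<bullet> s = z" for y z
  proof (intro exI conjI)
    \<comment> \<open>The \<open>e\<close>-coordinate is fixed by \<open>y\<close>. In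
      \<open>n2\<close> the form \<open>m\<close> has the nonzero coefficient
      \<open>- H / b\<close>, so the \<open>d\<close>-coordinate can be solved for.\<close>
    define s where "s = (((of_int \<alpha> - real a) * y - real b * z) / real H) *\<^sub>R d + y *\<^sub>R e"
    show "n1 \<bullet> s = y" by (simp add: s_def inner_add_right coords)
    moreover have "m \<bullet> s = ((of_int \<alpha> - real a) * y - real b * z) / real H"
      by (simp add: s_def inner_add_right coords)
    ultimately show "n2 \<bullet> s = z"
      using pos H by (simp add: n2_def inner_diff_left)
  qed
  show ?thesis using that[OF inL(2) n2L n3L sum0 solve count] by blast
qed

subsection \<open>The law of the lattice count\<close>

text \<open>Lattice points are coded by natural numbers, which reduces the claim to the cardinality
  of a measurably varying set of naturals.\<close>

lemma lattice_count_measurable: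
  assumes [measurable]: "T \<in> sets borel"
  shows "lattice_count T \<in> measurable borel (count_space UNIV)"
proof -
  define g :: "int \<times> int \<Rightarrow> real^2" where "g = (\<lambda>(i, j). vector [of_int i, of_int j])"
  have g: "integer_lattice = range g"
    by (auto simp: g_def elim!: integer_latticeE) (simp_all add: vector_2_in_integer_lattice)
  have inj: "inj g"
    unfolding g_def by (rule injI) (auto simp: vec_eq_iff forall_2)
  define S where "S x = {n. to_nat (from_nat n :: int \<times> int) = n \<and> g (from_nat n) - x \<in> T}" for x
  have "lattice_count T x = card (S x)" for x
  proof -
    have "(\<lambda>t. t + x) ` T \<inter> integer_lattice = g ` from_nat ` S x"
    proof (intro equalityI subsetI)
      fix y assume y: "y \<in> (\<lambda>t. t + x) ` T \<inter> integer_lattice"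
      then obtain p where p: "y = g p" using g by blast
      have "g p - x \<in> T" using y p by auto
      then have "to_nat p \<in> S x" by (simp add: S_def)
      then show "y \<in> g ` from_nat ` S x" using p by (metis from_nat_to_nat image_eqI)
    next
      fix y assume "y \<in> g ` from_nat ` S x"
      then obtain n where n: "y = g (from_nat n)" "n \<in> S x" by blast
      then have "y - x \<in> T" by (simp add: S_def)
      then have "y \<in> (\<lambda>t. t + x) ` T" by (metis diff_add_cancel image_eqI)
      then show "y \<in> (\<lambda>t. t + x) ` T \<inter> integer_lattice" using n by (simp add: g)
    qed
    moreover have "inj_on (from_nat :: nat \<Rightarrow> int \<times> int) (S x)"
      unfolding S_def by (rule inj_onI) (metis (mono_tags, lifting) mem_Collect_eq)
    ultimately show ?thesis
      using inj by (simp add: lattice_count_def card_image inj_on_subset)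
  qed
  moreover have "(\<lambda>x. card (S x)) \<in> measurable borel (count_space UNIV)"
    unfolding S_def by measurable
  ultimately show ?thesis by (subst measurable_cong) auto
qed

lemma frac_inner_axis:
  assumes "n \<in> integer_lattice"
  shows "frac (n \<bullet> (x + axis i 1)) = frac (n \<bullet> x)"
  using assms by (simp add: inner_add_right inner_axis integer_lattice_def frac_add_int_right)

lemma borel_measurable_frac [measurable]: "(frac :: real \<Rightarrow> real) \<in> borel_measurable borel"
  unfolding frac_def by measurable

text \<open>The sum of fractional parts is an integer because \<open>x + y + z = 0\<close>, and it
  lies strictly between 0 and 3.\<close>

lemma sum_frac_cases:
  fixes x y z :: real
  assumes "x + y + z = 0" "x \<notin> \<int>" "y \<notin> \<int>" "z \<notin> \<int>"
  shows "frac x + frac y + frac z = 1 \<or> frac x + frac y + frac z = 2"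
proof -
  have "frac x + frac y + frac z = of_int (- (\<lfloor>x\<rfloor> + \<lfloor>y\<rfloor> + \<lfloor>z\<rfloor>))" (is "?l = of_int ?k")
    using assms(1) by (simp add: frac_def)
  moreover have "0 < ?l" "?l < 3"
    using assms(2-4) frac_lt_1[of x] frac_lt_1[of y] frac_lt_1[of z] frac_gt_0_iff[of x]
      frac_gt_0_iff[of y] frac_gt_0_iff[of z] by linarith+
  ultimately have "0 < ?k" "?k < 3" by linarith+
  then have "?k = 1 \<or> ?k = 2" by linarith
  then show ?thesis using \<open>?l = of_int ?k\<close> by (metis of_int_1 of_int_numeral)
qed

lemma inner_surj_nonzero:
  fixes n1 n2 n3 :: "'a::real_inner" and a b c :: real
  assumes sum0: "a *\<^sub>R n1 + b *\<^sub>R n2 + c *\<^sub>R n3 = 0"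
    and solve: "\<And>y z. \<exists>s. n1 \<bullet> s = y \<and> n2 \<bullet> s = z" and a: "a \<noteq> 0"
  shows "n1 \<noteq> 0" "n2 \<noteq> 0" "n3 \<noteq> 0"
proof -
  show "n1 \<noteq> 0" "n2 \<noteq> 0" using solve[of 1 1] by auto
  obtain s where s: "n1 \<bullet> s = 1" "n2 \<bullet> s = 0" using solve by blast
  have "a * (n1 \<bullet> s) + b * (n2 \<bullet> s) + c * (n3 \<bullet> s) = 0"
    using arg_cong[OF sum0, of "\<lambda>v. v \<bullet> s"] by (simp add: inner_add_left)
  then show "n3 \<noteq> 0" using s a by auto
qed

text \<open>The law is tested against an arbitrary \<phi>, and the factor
  \<open>a * b * c * 2\<close> avoids division in \<open>ennreal\<close>. The offset 1 on the right
  is the smaller of the two values of \<open>Z\<close>.\<close>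

lemma nn_integral_frac_sum:
  fixes n1 n2 n3 :: "real^2" and a b c :: nat and \<phi> :: "real \<Rightarrow> ennreal"
  assumes L: "n1 \<in> integer_lattice" "n2 \<in> integer_lattice" "n3 \<in> integer_lattice"
    and sum0: "real a *\<^sub>R n1 + real b *\<^sub>R n2 + real c *\<^sub>R n3 = 0"
    and solve: "\<And>y z. \<exists>s. n1 \<bullet> s = y \<and> n2 \<bullet> s = z"
    and pos: "0 < a" "0 < b" "0 < c" and coprime: "gcd a (gcd b c) = 1"
    and \<phi>[measurable]: "\<phi> \<in> borel_measurable borel"
  shows "of_nat (a * b * c * 2)
      * (\<integral>\<^sup>+x. \<phi> (real a * frac (n1 \<bullet> x) + real b * frac (n2 \<bullet> x) + real c * frac (n3 \<bullet> x)) \<partial>unit_cube)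
    = (\<Sum>i<a. \<Sum>j<b. \<Sum>k<c. \<Sum>l<2. \<phi> (real (i + j + k + l) + 1))"
proof -
  define F where "F x = \<phi> (real a * frac (n1 \<bullet> x) + real b * frac (n2 \<bullet> x) + real c * frac (n3 \<bullet> x))" for x
  define Z where "Z x = frac (real a * (n1 \<bullet> x)) + frac (real b * (n2 \<bullet> x)) + frac (real c * (n3 \<bullet> x))" for x
  define G where "G x = (\<Sum>i<a. \<Sum>j<b. \<Sum>k<c. \<phi> (Z x + real (i + j + k)))" for x
  have F[measurable]: "F \<in> borel_measurable borel" unfolding F_def by measurable
  have Fper: "unit_periodic F" unfolding unit_periodic_def F_def by (simp add: frac_inner_axis L)
  have aL: "real k *\<^sub>R n \<in> integer_lattice" if "n \<in> integer_lattice" for k n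
    using that by (simp add: integer_lattice_def)
  have Z: "Z x = frac ((real a *\<^sub>R n1) \<bullet> x) + frac ((real b *\<^sub>R n2) \<bullet> x) + frac ((real c *\<^sub>R n3) \<bullet> x)" for x
    by (simp add: Z_def)
  have [measurable]: "Z \<in> borel_measurable borel" unfolding Z by measurable
  have G[measurable]: "G \<in> borel_measurable borel" unfolding G_def by measurable
  have Gper: "unit_periodic G" unfolding unit_periodic_def G_def Z by (simp only: frac_inner_axis aL L simp_thms)
  have sum0': "real a * (n1 \<bullet> x) + real b * (n2 \<bullet> x) + real c * (n3 \<bullet> x) = 0" for x
    using arg_cong[OF sum0, of "\<lambda>v. v \<bullet> x"] by (simp add: inner_add_left)

  txt \<open>Shifting \<open>x\<close> moves the three linear forms by \<open>i / a\<close>, \<open>j / b\<close>, \<open>k / c\<close> modulo 1;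
    a suitable shift exists for all \<open>i\<close>, \<open>j\<close>, \<open>k\<close> because the gcd is 1.\<close>
  have shifted: "(\<integral>\<^sup>+x. \<phi> (real a * frac (n1 \<bullet> x + real i / real a) + real b * frac (n2 \<bullet> x + real j / real b)
      + real c * frac (n3 \<bullet> x + real k / real c)) \<partial>unit_cube) = (\<integral>\<^sup>+x. F x \<partial>unit_cube)" for i j k
  proof -
    obtain u w where uw: "u * int b + w * int c = gcd (int b) (int c)" using bezout_int by blast
    obtain u' w' where "u' * int a + w' * gcd (int b) (int c) = gcd (int a) (gcd (int b) (int c))"
      using bezout_int by blast
    moreover have "gcd (int a) (gcd (int b) (int c)) = 1"
      using coprime by (metis gcd_int_int_eq of_nat_1)
    ultimately have bez: "u' * int a + (w' * u) * int b + (w' * w) * int c = 1"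
      unfolding uw[symmetric] by (simp add: algebra_simps)
    \<comment> \<open>The relation between the forms forces
      \<open>a * y1 + b * y2 + c * y3 = 0\<close> for the values at \<open>s\<close>, but the
      desired shifts give \<open>i + j + k\<close>. Subtracting \<open>t\<close> times the Bezout
      coefficients corrects this and changes the shifts only by integers.\<close>
    define t where "t = int (i + j + k)"
    obtain s where s: "n1 \<bullet> s = real i / real a - of_int (t * u')" "n2 \<bullet> s = real j / real b - of_int (t * (w' * u))"
      using solve by blast
    have "real c * (n3 \<bullet> s) = - (real a * (n1 \<bullet> s)) - real b * (n2 \<bullet> s)"
      using sum0'[of s] by linarith
    also have "\<dots> = of_int (t * (u' * int a + (w' * u) * int b + (w' * w) * int c)) - real i - real j - real c * of_int (t * (w' * w))"
      unfolding s using pos by (simp add: algebra_simps)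
    also have "\<dots> = real k - real c * of_int (t * (w' * w))"
      unfolding bez by (simp add: t_def)
    finally have s3: "n3 \<bullet> s = real k / real c - of_int (t * (w' * w))"
      using pos by (simp add: field_simps)
    have fr: "frac (y + (z - of_int m)) = frac (y + z)" for y z :: real and m
      using frac_add_of_int_right[of "y + z" "- m"] by (simp add: algebra_simps)
    have "F (x + s) = \<phi> (real a * frac (n1 \<bullet> x + real i / real a) + real b * frac (n2 \<bullet> x + real j / real b)
      + real c * frac (n3 \<bullet> x + real k / real c))" for x
      unfolding F_def inner_add_right s s3 fr ..
    then show ?thesis using nn_integral_unit_cube_shift[OF F Fper, of s] by simp
  qed
  have "of_nat (a * b * c) * (\<integral>\<^sup>+x. F x \<partial>unit_cube) = (\<Sum>i<a. \<Sum>j<b. \<Sum>k<c. (\<integral>\<^sup>+x. F x \<partial>unit_cube))"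
    by (simp add: mult.assoc)
  also have "\<dots> = (\<integral>\<^sup>+x. (\<Sum>i<a. \<Sum>j<b. \<Sum>k<c. \<phi> (real a * frac (n1 \<bullet> x + real i / real a)
      + real b * frac (n2 \<bullet> x + real j / real b) + real c * frac (n3 \<bullet> x + real k / real c))) \<partial>unit_cube)"
    by (simp add: nn_integral_sum shifted)
  also have "\<dots> = (\<integral>\<^sup>+x. G x \<partial>unit_cube)"
  proof (rule nn_integral_cong)
    fix x
    have "(\<Sum>i<a. \<Sum>j<b. \<Sum>k<c. \<phi> (real a * frac (n1 \<bullet> x + real i / real a)
        + real b * frac (n2 \<bullet> x + real j / real b) + real c * frac (n3 \<bullet> x + real k / real c)))
      = (\<Sum>i<a. \<Sum>j<b. \<Sum>k<c. \<phi> ((frac (real a * (n1 \<bullet> x)) + real i)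
        + (frac (real b * (n2 \<bullet> x)) + real j) + (frac (real c * (n3 \<bullet> x)) + real k)))"
      \<comment> \<open>The sums are treated from the innermost outwards, each with the other two
        terms held fixed.\<close>
      unfolding sum_frac_shift[OF pos(3), where g = "\<lambda>t. \<phi> (_ + t)"]
        sum_frac_shift[OF pos(2), where g = "\<lambda>t. \<Sum>k<c. \<phi> (_ + t + _ k)"]
        sum_frac_shift[OF pos(1), where g = "\<lambda>t. \<Sum>j<b. \<Sum>k<c. \<phi> (t + _ j + _ k)"] ..
    also have "\<dots> = G x" by (simp add: G_def Z_def add_ac)
    finally show "(\<Sum>i<a. \<Sum>j<b. \<Sum>k<c. \<phi> (real a * frac (n1 \<bullet> x + real i / real a)
        + real b * frac (n2 \<bullet> x + real j / real b) + real c * frac (n3 \<bullet> x + real k / real c))) = G x" .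
  qed
  finally have FG: "of_nat (a * b * c) * (\<integral>\<^sup>+x. F x \<partial>unit_cube) = (\<integral>\<^sup>+x. G x \<partial>unit_cube)" .

  txt \<open>Outside a null set \<open>Z x \<in> {1, 2}\<close> and \<open>Z (- x) = 3 - Z x\<close>.\<close>
  define K where "K = (\<Sum>i<a. \<Sum>j<b. \<Sum>k<c. \<Sum>l<2. \<phi> (real (i + j + k + l) + 1))"
  have "AE x in unit_cube. G x + G (- x) = K"
  proof (rule AE_unit_cubeI)
    have ne: "n1 \<noteq> 0" "n2 \<noteq> 0" "n3 \<noteq> 0" using inner_surj_nonzero[OF sum0 solve] pos by auto
    have "AE x in lborel. (real a *\<^sub>R n1) \<bullet> x \<notin> \<int> \<and> (real b *\<^sub>R n2) \<bullet> x \<notin> \<int> \<and> (real c *\<^sub>R n3) \<bullet> x \<notin> \<int>"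
      using ne pos by (intro AE_conjI AE_inner_notin_Ints) auto
    then show "AE x in lborel. G x + G (- x) = K"
    proof eventually_elim
      case (elim x)
      then have ni: "real a * (n1 \<bullet> x) \<notin> \<int>" "real b * (n2 \<bullet> x) \<notin> \<int>" "real c * (n3 \<bullet> x) \<notin> \<int>" by simp_all
      have "Z (- x) = 3 - Z x" unfolding Z_def using ni by (simp add: frac_neg)
      moreover have "Z x = 1 \<or> Z x = 2" unfolding Z_def using sum_frac_cases[OF sum0' ni] .
      \<comment> \<open>\<open>Z x\<close> and \<open>Z (- x)\<close> are 1 and 2 in some order,
        that is, \<open>l + 1\<close> for the two values of \<open>l\<close>.\<close>
      ultimately show "G x + G (- x) = K"
        unfolding G_def K_def sum.distrib[symmetric]
        by (auto simp: numeral_2_eq_2 add_ac intro!: sum.cong)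
    qed
  qed
  then have "(\<integral>\<^sup>+x. G x + G (- x) \<partial>unit_cube) = (\<integral>\<^sup>+(x::real^2). K \<partial>unit_cube)"
    by (rule nn_integral_cong_AE)
  also have "\<dots> = K" by (simp only: nn_integral_const prob_space.emeasure_space_1[OF prob_space_unit_cube] mult_1_right)
  finally have "(\<integral>\<^sup>+x. G x \<partial>unit_cube) + (\<integral>\<^sup>+x. G (- x) \<partial>unit_cube) = K"
    by (subst (asm) nn_integral_add) (auto simp: nn_integral_add)
  \<comment> \<open>Reflection preserves the integral of \<open>G\<close>, so twice that integral is
    \<open>K\<close>.\<close>
  then have "(\<integral>\<^sup>+x. G x \<partial>unit_cube) + (\<integral>\<^sup>+x. G x \<partial>unit_cube) = K"
    unfolding nn_integral_unit_cube_uminus[OF G Gper] .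
  then show ?thesis
    unfolding FG[symmetric] K_def[symmetric] F_def[symmetric]
    by (simp add: mult_2_right distrib_right)
qed

section \<open>Sums of independent uniform variables\<close>

context prob_space
begin

lemma AE_less_of_distr_uniform:
  fixes V :: "'a \<Rightarrow> nat"
  assumes V: "random_variable (count_space UNIV) V"
    and d: "distr M (count_space UNIV) V = measure_pmf (pmf_of_set {0..<n})" and n: "0 < n"
  shows "AE \<omega> in M. V \<omega> < n"
proof -
  have "AE k in measure_pmf (pmf_of_set {0..<n}). k < n"
    using n by (auto simp: AE_measure_pmf_iff set_pmf_of_set)
  then show ?thesis
    unfolding d[symmetric] by (subst (asm) AE_distr_iff) (auto simp: V)
qed

lemma prob_eq_of_distr_uniform:
  fixes V :: "'a \<Rightarrow> nat"
  assumes V: "random_variable (count_space UNIV) V"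
    and d: "distr M (count_space UNIV) V = measure_pmf (pmf_of_set {0..<n})" and k: "k < n"
  shows "prob (V -` {k} \<inter> space M) = 1 / real n"
proof -
  have "prob (V -` {k} \<inter> space M) = measure (distr M (count_space UNIV) V) {k}"
    using V by (simp add: measure_distr)
  also have "\<dots> = 1 / real n"
    using k by (simp add: d measure_pmf_single pmf_of_set)
  finally show ?thesis .
qed

text \<open>By independence the vector of the four variables is uniform on a box of
  \<open>n 0 * n 1 * n 2 * n 3\<close> points, so the expectation is an average over the
  box.\<close>

lemma nn_integral_indep_uniform_sum:
  fixes U :: "nat \<Rightarrow> 'a \<Rightarrow> nat" and n :: "nat \<Rightarrow> nat" and \<phi> :: "nat \<Rightarrow> ennreal"
  assumes indep: "indep_vars (\<lambda>_. count_space UNIV) U {0, 1, 2, 3}"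
    and d: "\<And>i. i \<in> {0, 1, 2, 3} \<Longrightarrow> distr M (count_space UNIV) (U i) = measure_pmf (pmf_of_set {0..<n i})"
    and n: "\<And>i. i \<in> {0, 1, 2, 3} \<Longrightarrow> 0 < n i"
  shows "of_nat (n 0 * n 1 * n 2 * n 3) * (\<integral>\<^sup>+\<omega>. \<phi> (U 0 \<omega> + U 1 \<omega> + U 2 \<omega> + U 3 \<omega>) \<partial>M)
    = (\<Sum>i<n 0. \<Sum>j<n 1. \<Sum>k<n 2. \<Sum>l<n 3. \<phi> (i + j + k + l))"
proof -
  define I :: "nat set" where "I = {0, 1, 2, 3}"
  have [measurable]: "random_variable (count_space UNIV) (U i)" if "i \<in> I" for i
    using indep that unfolding indep_vars_def I_def by blast
  have [measurable]: "random_variable (count_space UNIV) (U 0)" "random_variable (count_space UNIV) (U 1)"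
    "random_variable (count_space UNIV) (U 2)" "random_variable (count_space UNIV) (U 3)"
    using indep unfolding indep_vars_def by blast+
  define V where "V \<omega> = (U 0 \<omega>, U 1 \<omega>, U 2 \<omega>, U 3 \<omega>)" for \<omega>
  define P where "P = {..<n 0} \<times> {..<n 1} \<times> {..<n 2} \<times> {..<n 3}"
  define h :: "nat \<times> nat \<times> nat \<times> nat \<Rightarrow> nat" where "h = (\<lambda>(i, j, k, l). i + j + k + l)"
  define q where "q = n 0 * n 1 * n 2 * n 3"
  have q: "0 < q" using n by (simp add: q_def)
  have "AE \<omega> in M. \<forall>i\<in>I. U i \<omega> < n i"
    using d n by (auto simp: I_def intro!: AE_finite_allI AE_less_of_distr_uniform)
  \<comment> \<open>Almost surely \<open>V\<close> lies in the box, so exactly one indicator is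
    nonzero.\<close>
  then have AE: "AE \<omega> in M. \<phi> (h (V \<omega>)) = (\<Sum>p\<in>P. \<phi> (h p) * indicator (V -` {p} \<inter> space M) \<omega>)"
    using AE_space
  proof eventually_elim
    case (elim \<omega>)
    have "V \<omega> \<in> P" "finite P" using elim by (auto simp: V_def P_def I_def)
    moreover have "(\<Sum>p\<in>P. \<phi> (h p) * indicator (V -` {p} \<inter> space M) \<omega>) = (\<Sum>p\<in>P. if V \<omega> = p then \<phi> (h p) else 0)"
      using elim by (intro sum.cong) auto
    ultimately show ?case by (simp add: sum.delta')
  qed
  have em: "V -` {p} \<inter> space M \<in> events \<and> emeasure M (V -` {p} \<inter> space M) = ennreal (1 / real q)" if p: "p \<in> P" for p
  proof -
    obtain i j k l where ijkl: "p = (i, j, k, l)" by (cases p)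
    have "V -` {p} \<inter> space M = {\<omega> \<in> space M. U 0 \<omega> = i \<and> U 1 \<omega> = j \<and> U 2 \<omega> = k \<and> U 3 \<omega> = l}"
      by (auto simp: V_def ijkl)
    also have "\<dots> \<in> events" by measurable
    finally have ev: "V -` {p} \<inter> space M \<in> events" .
    \<comment> \<open>The singletons of the coordinates of \<open>p\<close>, indexed to match the
      family \<open>U\<close>.\<close>
    define A where "A m = {[i, j, k, l] ! m}" for m
    have "V -` {p} \<inter> space M = (\<Inter>m\<in>I. U m -` A m \<inter> space M)"
      by (auto simp: V_def ijkl I_def A_def numeral_2_eq_2 numeral_3_eq_3)
    moreover have "prob (\<Inter>m\<in>I. U m -` A m \<inter> space M) = (\<Prod>m\<in>I. prob (U m -` A m \<inter> space M))"
      using indep by (intro indep_varsD[where I = I and M' = "\<lambda>_. count_space UNIV"]) (auto simp: I_def)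
    also have "\<dots> = (\<Prod>m\<in>I. 1 / real (n m))"
    proof (rule prod.cong)
      fix m assume m: "m \<in> I"
      then have "[i, j, k, l] ! m < n m"
        using p by (auto simp: I_def P_def ijkl numeral_2_eq_2 numeral_3_eq_3)
      then show "prob (U m -` A m \<inter> space M) = 1 / real (n m)"
        using m d[of m] unfolding A_def by (intro prob_eq_of_distr_uniform) (auto simp: I_def)
    qed simp
    also have "\<dots> = 1 / real q" by (simp add: I_def q_def)
    ultimately show ?thesis using ev by (simp add: emeasure_eq_measure)
  qed
  have "(\<integral>\<^sup>+\<omega>. \<phi> (h (V \<omega>)) \<partial>M) = (\<integral>\<^sup>+\<omega>. (\<Sum>p\<in>P. \<phi> (h p) * indicator (V -` {p} \<inter> space M) \<omega>) \<partial>M)"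
    by (rule nn_integral_cong_AE) (rule AE)
  also have "\<dots> = (\<Sum>p\<in>P. \<integral>\<^sup>+\<omega>. \<phi> (h p) * indicator (V -` {p} \<inter> space M) \<omega> \<partial>M)"
  proof (rule nn_integral_sum)
    fix p assume "p \<in> P"
    then have [measurable]: "V -` {p} \<inter> space M \<in> events" using em by blast
    show "(\<lambda>\<omega>. \<phi> (h p) * indicator (V -` {p} \<inter> space M) \<omega>) \<in> borel_measurable M" by measurable
  qed
  also have "\<dots> = (\<Sum>p\<in>P. \<phi> (h p) * ennreal (1 / real q))"
    by (intro sum.cong refl) (use em in \<open>simp add: nn_integral_cmult_indicator\<close>)
  finally have "of_nat q * (\<integral>\<^sup>+\<omega>. \<phi> (h (V \<omega>)) \<partial>M) = (\<Sum>p\<in>P. \<phi> (h p)) * (ennreal (1 / real q) * of_nat q)"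
    by (simp add: sum_distrib_right[symmetric] mult_ac)
  also have "ennreal (1 / real q) * of_nat q = 1"
    using q by (simp add: ennreal_of_nat_eq_real_of_nat ennreal_mult[symmetric])
  also have "(\<Sum>p\<in>P. \<phi> (h p)) * 1 = (\<Sum>i<n 0. \<Sum>j<n 1. \<Sum>k<n 2. \<Sum>l<n 3. \<phi> (i + j + k + l))"
    by (simp add: P_def h_def sum.cartesian_product case_prod_beta)
  finally show ?thesis by (simp add: q_def h_def V_def)
qed

end

lemma emeasure_distr_eq_nn_integral:
  assumes f: "f \<in> measurable M N" and D: "D \<in> sets N"
  shows "emeasure (distr M N f) D = (\<integral>\<^sup>+\<omega>. indicator D (f \<omega>) \<partial>M)"
proof -
  have "emeasure (distr M N f) D = (\<integral>\<^sup>+y. indicator D y \<partial>distr M N f)"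
    using D by (simp only: nn_integral_indicator sets_distr)
  also have "\<dots> = (\<integral>\<^sup>+\<omega>. indicator D (f \<omega>) \<partial>M)"
    using D by (intro nn_integral_distr f borel_measurable_indicator) simp
  finally show ?thesis .
qed

theorem theorem3:
  fixes A B C :: "real^2" and T :: "(real^2) set" and a b c :: nat
    and M :: "'m measure" and X :: "'m \<Rightarrow> real^2" and XT :: "'m \<Rightarrow> real"
    and N :: "'n measure" and U :: "nat \<Rightarrow> 'n \<Rightarrow> nat" and S :: "'n \<Rightarrow> real"
  assumes vertices: "A \<in> integer_lattice" "B \<in> integer_lattice" "C \<in> integer_lattice"
    and nondegenerate: "\<not> collinear {A, B, C}"
    and T: "T = convex hull {A, B, C}"
    and side_lengths: "a = affine_length B C" "b = affine_length C A" "c = affine_length A B"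
    and coprime: "gcd a (gcd b c) = 1"
    and M: "prob_space M"
    and X: "X \<in> borel_measurable M" "distr M borel X = uniform_measure lborel (cbox 0 1)"
    and XT: "XT = (\<lambda>\<omega>. real (lattice_count T (X \<omega>)))"
    and N: "prob_space N"
    and indep: "prob_space.indep_vars N (\<lambda>_. count_space UNIV) U {0, 1, 2, 3}"
    and U: "distr N (count_space UNIV) (U 0) = measure_pmf (pmf_of_set {0..<a})"
      "distr N (count_space UNIV) (U 1) = measure_pmf (pmf_of_set {0..<b})"
      "distr N (count_space UNIV) (U 2) = measure_pmf (pmf_of_set {0..<c})"
      "distr N (count_space UNIV) (U 3) = measure_pmf (pmf_of_set {0..<2})"
    and S: "S = (\<lambda>\<omega>. real (U 0 \<omega> + U 1 \<omega> + U 2 \<omega> + U 3 \<omega>))"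
  shows "distr M borel (\<lambda>\<omega>. XT \<omega> - integral\<^sup>L M XT) = distr N borel (\<lambda>\<omega>. S \<omega> - integral\<^sup>L N S)"
proof -
  interpret M: prob_space M by (rule M)
  interpret N: prob_space N by (rule N)
  have ne: "B \<noteq> C" "C \<noteq> A" "A \<noteq> B"
    using nondegenerate by (auto simp: insert_commute)
  have pos: "0 < a" "0 < b" "0 < c"
    using affine_length_pos vertices ne side_lengths by blast+
  obtain n1 n2 n3 :: "real^2" and \<kappa> :: real
    where L: "n1 \<in> integer_lattice" "n2 \<in> integer_lattice" "n3 \<in> integer_lattice"
      and sum0: "real a *\<^sub>R n1 + real b *\<^sub>R n2 + real c *\<^sub>R n3 = 0"
      and solve: "\<And>y z. \<exists>s. n1 \<bullet> s = y \<and> n2 \<bullet> s = z"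
      and count: "\<And>x. n1 \<bullet> x \<notin> \<int> \<Longrightarrow> n2 \<bullet> x \<notin> \<int> \<Longrightarrow> n3 \<bullet> x \<notin> \<int> \<Longrightarrow>
        real (lattice_count T x)
          = \<kappa> + real a * frac (n1 \<bullet> x) + real b * frac (n2 \<bullet> x) + real c * frac (n3 \<bullet> x)"
    using lattice_count_triangle[OF vertices nondegenerate] unfolding T side_lengths by metis
  define W where "W x = real a * frac (n1 \<bullet> x) + real b * frac (n2 \<bullet> x) + real c * frac (n3 \<bullet> x)" for x
  have [measurable]: "W \<in> borel_measurable borel" unfolding W_def by measurable
  have count_AE: "AE x in unit_cube. real (lattice_count T x) = \<kappa> + W x"
  proof (rule AE_unit_cubeI)
    have ne: "n1 \<noteq> 0" "n2 \<noteq> 0" "n3 \<noteq> 0" using inner_surj_nonzero[OF sum0 solve] pos by auto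
    have "AE x in lborel. n1 \<bullet> x \<notin> \<int> \<and> n2 \<bullet> x \<notin> \<int> \<and> n3 \<bullet> x \<notin> \<int>"
      using ne by (intro AE_conjI AE_inner_notin_Ints)
    then show "AE x in lborel. real (lattice_count T x) = \<kappa> + W x"
      by eventually_elim (simp add: count W_def)
  qed
  have "compact T" unfolding T by (simp add: finite_imp_compact_convex_hull)
  then have "T \<in> sets borel" by (simp add: compact_imp_closed)
  note [measurable] = lattice_count_measurable[OF this] X(1)
  have XT_meas [measurable]: "XT \<in> borel_measurable M"
    unfolding XT by measurable
  define n where "n i = [a, b, c, 2] ! i" for i
  have n: "n 0 = a" "n 1 = b" "n 2 = c" "n 3 = 2" by (simp_all add: n_def numeral_2_eq_2 numeral_3_eq_3)
  have Ud: "distr N (count_space UNIV) (U i) = measure_pmf (pmf_of_set {0..<n i})"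
    and npos: "0 < n i" if "i \<in> {0, 1, 2, 3}" for i
    using that U pos n by auto
  have U_meas [measurable]: "U i \<in> measurable N (count_space UNIV)" if "i \<in> {0, 1, 2, 3}" for i
    using indep that unfolding N.indep_vars_def by blast
  have [measurable]: "U 0 \<in> measurable N (count_space UNIV)" "U 1 \<in> measurable N (count_space UNIV)"
    "U 2 \<in> measurable N (count_space UNIV)" "U 3 \<in> measurable N (count_space UNIV)"
    using U_meas by auto
  have S_meas [measurable]: "S \<in> borel_measurable N" unfolding S by measurable
  have "AE \<omega> in N. \<forall>i\<in>{0, 1, 2, 3}. U i \<omega> < n i"
    using Ud npos by (intro AE_finite_allI N.AE_less_of_distr_uniform U_meas) auto
  \<comment> \<open>A crude bound; boundedness makes \<open>S\<close> integrable, so adding a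
    constant shifts its mean.\<close>
  then have "AE \<omega> in N. norm (S \<omega>) \<le> real (a + b + c + 2)"
    by eventually_elim (simp add: S n[simplified])
  then have S_int: "integrable N S"
    by (rule N.integrable_const_bound) (rule S_meas)

  \<comment> \<open>The constant \<kappa> comes from the counting formula, the 1 from
    \<open>Z\<close> being distributed as one plus a fair bit.\<close>
  have law: "distr M borel XT = distr N borel (\<lambda>\<omega>. S \<omega> + (1 + \<kappa>))"
  proof (rule measure_eqI)
    fix D assume "D \<in> sets (distr M borel XT)"
    then have D[measurable]: "D \<in> sets borel" by simp
    define \<phi> :: "real \<Rightarrow> ennreal" where "\<phi> y = indicator D (\<kappa> + y)" for y
    have \<phi>[measurable]: "\<phi> \<in> borel_measurable borel" unfolding \<phi>_def by measurable
    have "emeasure (distr M borel XT) D = (\<integral>\<^sup>+\<omega>. indicator D (real (lattice_count T (X \<omega>))) \<partial>M)"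
      using emeasure_distr_eq_nn_integral[OF XT_meas D] by (simp add: XT)
    also have "\<dots> = (\<integral>\<^sup>+x. indicator D (real (lattice_count T x)) \<partial>distr M borel X)"
      by (subst nn_integral_distr) simp_all
    also have "\<dots> = (\<integral>\<^sup>+x. \<phi> (W x) \<partial>unit_cube)"
      unfolding X(2) \<phi>_def using count_AE by (intro nn_integral_cong_AE) (auto elim: eventually_mono)
    finally have XD: "emeasure (distr M borel XT) D = (\<integral>\<^sup>+x. \<phi> (W x) \<partial>unit_cube)" .
    have "emeasure (distr N borel (\<lambda>\<omega>. S \<omega> + (1 + \<kappa>))) D = (\<integral>\<^sup>+\<omega>. indicator D (S \<omega> + (1 + \<kappa>)) \<partial>N)"
      by (intro emeasure_distr_eq_nn_integral) measurable
    also have "\<dots> = (\<integral>\<^sup>+\<omega>. \<phi> (real (U 0 \<omega> + U 1 \<omega> + U 2 \<omega> + U 3 \<omega>) + 1) \<partial>N)"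
      by (simp add: \<phi>_def S add_ac)
    finally have SD: "emeasure (distr N borel (\<lambda>\<omega>. S \<omega> + (1 + \<kappa>))) D
      = (\<integral>\<^sup>+\<omega>. \<phi> (real (U 0 \<omega> + U 1 \<omega> + U 2 \<omega> + U 3 \<omega>) + 1) \<partial>N)" .
    \<comment> \<open>Both sides become the same fourfold sum; the factor is nonzero and finite, so
      it cancels.\<close>
    have "of_nat (a * b * c * 2) * emeasure (distr M borel XT) D
        = of_nat (a * b * c * 2) * emeasure (distr N borel (\<lambda>\<omega>. S \<omega> + (1 + \<kappa>))) D"
      unfolding XD SD W_def nn_integral_frac_sum[OF L sum0 solve pos coprime \<phi>]
      using N.nn_integral_indep_uniform_sum[OF indep Ud npos, of "\<lambda>m. \<phi> (real m + 1)"]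
      unfolding n by simp
    moreover have "(of_nat (a * b * c * 2) :: ennreal) \<noteq> 0" using pos by simp
    ultimately show "emeasure (distr M borel XT) D = emeasure (distr N borel (\<lambda>\<omega>. S \<omega> + (1 + \<kappa>))) D"
      by (simp only: ennreal_mult_cancel_left ennreal_of_nat_neq_top simp_thms)
  qed simp
  \<comment> \<open>The mean depends only on the law, so the means differ by
    \<open>1 + \<kappa>\<close> too, and centering removes this constant.\<close>
  have "integral\<^sup>L M XT = integral\<^sup>L (distr M borel XT) (\<lambda>x. x)"
    by (subst integral_distr) simp_all
  also have "\<dots> = (\<integral>\<omega>. S \<omega> + (1 + \<kappa>) \<partial>N)"
    unfolding law by (subst integral_distr) simp_all
  also have "\<dots> = integral\<^sup>L N S + (1 + \<kappa>)"
    using S_int by (simp add: N.prob_space)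
  finally have mean: "integral\<^sup>L M XT = integral\<^sup>L N S + (1 + \<kappa>)" .
  have "distr M borel (\<lambda>\<omega>. XT \<omega> - integral\<^sup>L M XT) = distr (distr M borel XT) borel (\<lambda>x. x - integral\<^sup>L M XT)"
    by (subst distr_distr) (simp_all add: comp_def)
  also have "\<dots> = distr N borel (\<lambda>\<omega>. S \<omega> + (1 + \<kappa>) - integral\<^sup>L M XT)"
    unfolding law by (subst distr_distr) (simp_all add: comp_def)
  also have "\<dots> = distr N borel (\<lambda>\<omega>. S \<omega> - integral\<^sup>L N S)"
    by (simp add: mean)
  finally show ?thesis .
qed

end
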